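(* Let $k$ and $n$ be positive integers with $k\le n$. Then, for any $\pi\in S_k$, $$\mathrm{Wg}_{k,n}(\pi)=\sum\ \mathrm{as}_{k,n}(\pi\sigma_{n-1}^{-1})\,\mathrm{as}_{k,n-1}(\sigma_{n-1}\sigma_{n-2}^{-1})\cdots\mathrm{as}_{k,k+1}(\sigma_{k+1}\sigma_k^{-1})\times a_k(\sigma_k,\tau_{k-1})\,a_{k-1}(\tau_{k-1},\tau_{k-2})\cdots a_2(\tau_2,e_1),$$ where the sum is over all sequences of permutations $$(\sigma_{n-1},\sigma_{n-2},\dots,\sigma_k,\tau_{k-1},\tau_{k-2},\dots,\tau_2)\in\underbrace{S_k\times\cdots\times S_k}_{n-k}\times S_{k-1}\times S_{k-2}\times\cdots\times S_2.$$ Equivalently, with the conventions $\sigma_n:=\pi$, $\tau_k:=\sigma_k$, and $\tau_1:=e_1$ (the identity of $S_1$), the summand is $\prod_{m=k+1}^{n}\mathrm{as}_{k,m}(\sigma_m\sigma_{m-1}^{-1})\cdot\prod_{j=2}^{k}a_j(\tau_j,\tau_{j-1})$, empty products being $1$ (in particular, when $n=k$ there are no summation variables $\sigma$ and $\sigma_k=\pi$).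
   Context: Rising factorial: $a^{\uparrow k}=\prod_{j=0}^{k-1}(a+j)$ for $k\ge1$, and $a^{\uparrow 0}=1$. $S_k$ is the symmetric group on $\{1,\dots,k\}$. Weingarten function: for $k\le n$ and $\pi\in S_k$, $$\mathrm{Wg}_{k,n}(\pi)=\mathbb{E}\bigl[u_{11}u_{22}\cdots u_{kk}\,\overline{u_{1\pi(1)}u_{2\pi(2)}\cdots u_{k\pi(k)}}\bigr],$$ where $U=(u_{ij})$ is a Haar-distributed matrix in the unitary group $\mathrm{U}(n)$. (It is a class function on $S_k$; equivalently, it is the convolution inverse in the group algebra $\mathbb{C}[S_k]$, with product $(f_1*f_2)(\pi)=\sum_{\sigma\in S_k}f_1(\sigma)f_2(\sigma^{-1}\pi)$, of the function $\pi\mapsto n^{\kappa(\pi)}$, where $\kappa(\pi)$ is the number of cycles of $\pi$, including fixed points.) Ascension function: for positive integers $k,n$ and $\sigma\in S_k$, $$\mathrm{as}_{k,n}(\sigma)=\sum_{t=0}^{\mathsf{f}(\sigma)}(-1)^{k-t}\binom{\mathsf{f}(\sigma)}{t}\frac{1}{n^{\uparrow(k-t)}},$$ where $\mathsf{f}(\sigma)$ is the number of fixed points of $\sigma$ in $\{1,\dots,k\}$. For $n\ge2$, the function $a_n\colon S_n\times S_{n-1}\to\mathbb{C}$ is $$a_n(\pi,\tau)=\sum_{t=0}^{\mathsf{f}(\pi,\tau)}(-1)^{n-t+1}\binom{\mathsf{f}(\pi,\tau)}{t}\frac{1}{n^{\uparrow(n-t)}},\qquad \mathsf{f}(\pi,\tau)=|\{i\in\{1,\dots,n-1\}:\pi(\tau(i))=i\}|.$$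 *)

theory Defs
  imports
    "HOL-Probability.Probability"
    "HOL-Combinatorics.Permutations"
    "Jordan_Normal_Form.Schur_Decomposition"
begin

definition unitary_group :: "nat \<Rightarrow> complex mat set" where
  "unitary_group n = {A \<in> carrier_mat n n. A * mat_adjoint A = 1\<^sub>m n}"

text \<open>
  The Borel space of the unitary group as a subspace of the \<open>n \<times> n\<close> complex matrices: the
  sigma-algebra pulled back from the product Borel sigma-algebra along the family of entries.
\<close>

definition unitary_borel :: "nat \<Rightarrow> complex mat measure" where
  "unitary_borel n =
     vimage_algebra (unitary_group n)
       (\<lambda>A. \<lambda>ij\<in>{..<n} \<times> {..<n}. A $$ ij)
       (PiM ({..<n} \<times> {..<n}) (\<lambda>_. borel))"

text \<open>
  The normalized Haar measure is characterized as the (unique) left-invariant Borel probability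
  measure; since the group is compact, it is also right-invariant.
\<close>

definition haar_unitary :: "nat \<Rightarrow> complex mat measure \<Rightarrow> bool" where
  "haar_unitary n \<mu> \<longleftrightarrow>
     prob_space \<mu> \<and> sets \<mu> = sets (unitary_borel n) \<and>
     (\<forall>V\<in>unitary_group n. distr \<mu> \<mu> (\<lambda>A. V * A) = \<mu>)"

text \<open>
  Permutations in \<open>S\<^sub>k\<close> are functions \<open>\<pi>\<close> with \<open>\<pi> permutes {1..k}\<close>. Matrix indices of the library
  start at \<open>0\<close>, so the entry \<open>u\<^sub>i\<^sub>j\<close> with \<open>i, j \<ge> 1\<close> is \<open>U $$ (i - 1, j - 1)\<close>. The dimension \<open>n\<close> is
  determined by the measure \<open>\<mu>\<close>, which is meant to satisfy \<open>haar_unitary n \<mu>\<close> with \<open>k \<le> n\<close>.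
\<close>

definition weingarten :: "complex mat measure \<Rightarrow> nat \<Rightarrow> (nat \<Rightarrow> nat) \<Rightarrow> complex" where
  "weingarten \<mu> k \<pi> =
     (\<integral>U. (\<Prod>i=1..k. U $$ (i - 1, i - 1)) * cnj (\<Prod>i=1..k. U $$ (i - 1, \<pi> i - 1)) \<partial>\<mu>)"

text \<open>
  The rising factorial is the library's \<^const>\<open>pochhammer\<close>. In both definitions below, the
  summation bound is at most \<open>k\<close> respectively \<open>n - 1\<close> for the intended arguments, so that the
  subtractions do not truncate.
\<close>

definition fixpoints :: "nat \<Rightarrow> (nat \<Rightarrow> nat) \<Rightarrow> nat" where
  "fixpoints k \<sigma> = card {i \<in> {1..k}. \<sigma> i = i}"

definition ascension :: "nat \<Rightarrow> nat \<Rightarrow> (nat \<Rightarrow> nat) \<Rightarrow> complex" where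
  "ascension k n \<sigma> =
     (\<Sum>t=0..fixpoints k \<sigma>.
        (-1) ^ (k - t) * of_nat (fixpoints k \<sigma> choose t) * (1 / pochhammer (of_nat n) (k - t)))"

definition fixpoints2 :: "nat \<Rightarrow> (nat \<Rightarrow> nat) \<Rightarrow> (nat \<Rightarrow> nat) \<Rightarrow> nat" where
  "fixpoints2 n \<pi> \<tau> = card {i \<in> {1..n - 1}. \<pi> (\<tau> i) = i}"

definition a_fun :: "nat \<Rightarrow> (nat \<Rightarrow> nat) \<Rightarrow> (nat \<Rightarrow> nat) \<Rightarrow> complex" where
  "a_fun n \<pi> \<tau> =
     (\<Sum>t=0..fixpoints2 n \<pi> \<tau>.
        (-1) ^ (n - t + 1) * of_nat (fixpoints2 n \<pi> \<tau> choose t) * (1 / pochhammer (of_nat n) (n - t)))"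

end

theory Submission
  imports Defs
begin

text \<open>
  The Weingarten functions of \<open>S\<^sub>0, S\<^sub>1, \<dots>, S\<^sub>n\<close> in a fixed dimension \<open>n\<close> are determined by a chain of
  linear equations, one for each \<open>k\<close> between \<open>1\<close> and \<open>n\<close>. Let \<open>J\<^sub>k\<close> be the sum of the transpositions of \<open>k\<close> with
  smaller numbers. Then, in the group algebra of \<open>S\<^sub>k\<close>, the product of \<open>n + J\<^sub>k\<close> with the Weingarten
  function of \<open>S\<^sub>k\<close> is the Weingarten function of \<open>S\<^sub>k\<^sub>-\<^sub>1\<close>, extended by zero. Because \<open>J\<^sub>k\<close> has
  norm at most \<open>k - 1 < n\<close> with respect to the supremum norm, \<open>n + J\<^sub>k\<close> is injective and the equations have at
  most one solution (\<open>weingarten_relation_unique\<close>). The theorem follows once both sides are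
  shown to solve them.
  
  For the Haar integrals this is \<open>weingarten_haar_relation\<close>. A sum over the row index of two factors is
  evaluated by the orthonormality of columns. The summands are again Weingarten functions by left invariance
  under permutation matrices, except when a row is repeated; left invariance under rotations of two
  rows reduces these cases to distinct rows (\<open>row_moment_repeated_row\<close>).
  
  For the sum over sequences, the sum is first read as an iterated kernel
  (\<open>ascension_chain_eq_sum\<close>): convolution with the ascension function raises the dimension from \<open>n - 1\<close> to
  \<open>n\<close>, and the kernel \<open>a_fun n\<close> leads from \<open>S\<^sub>n\<^sub>-\<^sub>1\<close> in dimension \<open>n - 1\<close> to \<open>S\<^sub>n\<close> in dimension \<open>n\<close>. Both
  steps preserve the equations because of
  \<open>(n + J\<^sub>k) * as\<^sub>k\<^sub>,\<^sub>n = as\<^sub>k\<^sub>-\<^sub>1\<^sub>,\<^sub>n * (n - 1 + J\<^sub>k)\<close> (\<open>ascension_jucys_murphy\<close>) and a similar identity for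
  \<open>a_fun n\<close> (\<open>descent_jucys_murphy\<close>). Multiplication by a transposition changes the number of fixed points by at most two,
  so the identities come down to Pascal's rule and to one recurrence for the
  alternating sums that define the two functions.
\<close>

section \<open>Values of the ascension function\<close>

text \<open>
  The ascension function sees \<open>\<sigma>\<close> only through its number of fixed points. Making that number a
  separate argument \<open>f\<close> allows the degree \<open>k\<close> and \<open>f\<close> to be shifted independently in recurrences.
\<close>

definition ascension_value :: "nat \<Rightarrow> nat \<Rightarrow> nat \<Rightarrow> complex" where
  "ascension_value n k f =
     (\<Sum>t=0..f. (-1) ^ (k - t) * of_nat (f choose t) * (1 / pochhammer (of_nat n) (k - t)))"

lemma ascension_eq: "ascension k n \<sigma> = ascension_value n k (fixpoints k \<sigma>)"
  by (simp add: ascension_def ascension_value_def)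

lemma a_fun_eq:
  assumes "0 < n"
  shows "a_fun n \<pi> \<tau> = - ascension_value n n (fixpoints2 n \<pi> \<tau>)"
  unfolding a_fun_def ascension_value_def sum_negf[symmetric] by (rule sum.cong) auto

lemma fixpoints_le: "fixpoints k \<sigma> \<le> k"
proof -
  have "card {i \<in> {1..k}. \<sigma> i = i} \<le> card {1..k}" by (rule card_mono) auto
  then show ?thesis by (simp add: fixpoints_def)
qed

text \<open>
  Pascal's rule, with the index of the second half shifted by one.
\<close>

lemma ascension_value_Suc:
  assumes "0 < k"
  shows "ascension_value n k (Suc f) = ascension_value n k f + ascension_value n (k - 1) f"
proof -
  define c where "c m = (-1) ^ m * (1 / pochhammer (of_nat n :: complex) m)" for m
  have v: "ascension_value n j f = (\<Sum>t\<le>f. of_nat (f choose t) * c (j - t))" for j f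
    unfolding ascension_value_def c_def by (intro sum.cong) (auto simp: atLeast0AtMost)
  have "(\<Sum>t\<le>Suc f. of_nat (Suc f choose t) * c (k - t))
      = c k + (\<Sum>t\<le>f. of_nat (Suc f choose Suc t) * c (k - Suc t))"
    by (subst sum.atMost_Suc_shift) simp
  also have "\<dots> = c k + (\<Sum>t\<le>f. of_nat (f choose Suc t) * c (k - Suc t))
                   + (\<Sum>t\<le>f. of_nat (f choose t) * c (k - 1 - t))"
    by (simp add: sum.distrib algebra_simps)
  also have "c k + (\<Sum>t\<le>f. of_nat (f choose Suc t) * c (k - Suc t))
      = (\<Sum>t\<le>Suc f. of_nat (f choose t) * c (k - t))"
    by (subst sum.atMost_Suc_shift) simp
  also have "\<dots> = (\<Sum>t\<le>f. of_nat (f choose t) * c (k - t))" by simp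
  finally show ?thesis unfolding v .
qed

text \<open>
  The coefficients \<open>c m = (-1)^m / pochhammer n m\<close> satisfy \<open>(n + m) * c (m + 1) = - c m\<close>. Hence the terms
  with index \<open>t\<close> on the left combine to \<open>t\<close> times the term \<open>(f choose t) * c (k - t)\<close>, and
  \<open>t * (f choose t) = f * (f - 1 choose t - 1)\<close>. The bound \<open>f < k\<close> keeps every index
  \<open>k - t\<close> positive.
\<close>

lemma ascension_value_recurrence:
  assumes "0 < n" "f < k"
  shows "of_nat (n + k - 1) * ascension_value n k f + ascension_value n (k - 1) f
       = of_nat f * ascension_value n (k - 1) (f - 1)"
proof -
  define c where "c m = (-1) ^ m * (1 / pochhammer (of_nat n :: complex) m)" for m
  have v: "ascension_value n j f = (\<Sum>t\<le>f. of_nat (f choose t) * c (j - t))" for j f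
    unfolding ascension_value_def c_def by (intro sum.cong) (auto simp: atLeast0AtMost)
  have c: "of_nat (n + m) * c (Suc m) = - c m" for m
  proof -
    have "pochhammer (of_nat n :: complex) m \<noteq> 0"
      using assms pochhammer_pos[of n m] by (simp add: pochhammer_of_nat)
    moreover have "(of_nat (n + m) :: complex) \<noteq> 0" using assms by (simp del: of_nat_add)
    ultimately show ?thesis unfolding c_def pochhammer_Suc by (simp add: divide_simps)
  qed
  have t: "of_nat (n + k - 1) * (of_nat (f choose t) * c (k - t)) + of_nat (f choose t) * c (k - 1 - t)
         = of_nat t * of_nat (f choose t) * c (k - t)" if "t \<le> f" for t
  proof -
    have "t < k" using assms that by simp
    then obtain m where m: "k = t + Suc m" using less_imp_Suc_add by auto
    have "c m = - (of_nat (n + m) * c (Suc m))" unfolding c by simp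
    then have e1: "c (k - 1 - t) = - (of_nat (n + m) * c (k - t))" using m by simp
    have e2: "of_nat (n + k - 1) = (of_nat t + of_nat (n + m) :: complex)" using m by simp
    show ?thesis unfolding e1 e2 by (simp add: algebra_simps del: of_nat_add)
  qed
  have "of_nat (n + k - 1) * ascension_value n k f + ascension_value n (k - 1) f
      = (\<Sum>t\<le>f. of_nat t * of_nat (f choose t) * c (k - t))"
    unfolding v sum_distrib_left sum.distrib[symmetric] using t by (intro sum.cong) auto
  also have "\<dots> = of_nat f * ascension_value n (k - 1) (f - 1)"
  proof (cases f)
    case (Suc e)
    have b: "of_nat (Suc t) * of_nat (Suc e choose Suc t) = (of_nat (Suc e) * of_nat (e choose t) :: complex)" for t
      by (metis Suc_times_binomial of_nat_mult)
    have b': "of_nat (Suc t) * (of_nat (Suc e choose Suc t) * x)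
        = of_nat (Suc e) * (of_nat (e choose t) * x)" for t and x :: complex
      using b by (simp only: mult.assoc[symmetric])
    show ?thesis unfolding v Suc
      by (subst sum.atMost_Suc_shift)
         (simp add: b' sum_distrib_left mult.assoc del: of_nat_Suc binomial_Suc_Suc)
  qed simp
  finally show ?thesis .
qed

section \<open>Fixed points after multiplication by a transposition\<close>

abbreviation transposition :: "nat \<Rightarrow> nat \<Rightarrow> nat \<Rightarrow> nat" where
  "transposition \<equiv> Transposition.transpose"

lemma transpose_comp_fixed_iff:
  assumes "i \<noteq> k"
  shows "(transposition i k \<circ> \<rho>) x = x \<longleftrightarrow>
     (if x = i then \<rho> i = k else if x = k then \<rho> k = i else \<rho> x = x)"
  using assms by (auto simp: Transposition.transpose_def)

text \<open>
  Multiplying by the transposition of \<open>i\<close> and \<open>k\<close> changes the status of \<open>i\<close> and \<open>k\<close> only: \<open>i\<close> is lost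
  if it was fixed, and it is gained if it was mapped to \<open>k\<close>. Losses stand on the left-hand side
  to avoid a truncated subtraction.
\<close>

lemma fixpoints_transpose_below:
  assumes "i \<in> {1..<k}"
  shows "fixpoints (k - 1) (transposition i k \<circ> \<rho>) + of_bool (\<rho> i = i)
       = fixpoints (k - 1) \<rho> + of_bool (\<rho> i = k)"
proof -
  let ?A = "{x \<in> {1..k - 1} - {i}. \<rho> x = x}"
  have ik: "i \<noteq> k" "i \<in> {1..k - 1}" using assms by auto
  have "(transposition i k \<circ> \<rho>) x = x \<longleftrightarrow> (if x = i then \<rho> i = k else \<rho> x = x)"
    if "x \<in> {1..k - 1}" for x
    using that ik(1) by (subst transpose_comp_fixed_iff) (auto split: if_splits)
  then have "{x \<in> {1..k - 1}. (transposition i k \<circ> \<rho>) x = x}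
      = {x \<in> {1..k - 1}. if x = i then \<rho> i = k else \<rho> x = x}"
    by blast
  also have "\<dots> = ?A \<union> (if \<rho> i = k then {i} else {})"
    using ik(2) by auto
  finally have 1: "fixpoints (k - 1) (transposition i k \<circ> \<rho>) = card ?A + of_bool (\<rho> i = k)"
    by (simp add: fixpoints_def)
  have "{x \<in> {1..k - 1}. \<rho> x = x} = ?A \<union> (if \<rho> i = i then {i} else {})"
    using ik(2) by auto
  then have 2: "fixpoints (k - 1) \<rho> = card ?A + of_bool (\<rho> i = i)"
    by (simp add: fixpoints_def)
  show ?thesis unfolding 1 2 by simp
qed

lemma fixpoints_split_last:
  assumes "0 < k"
  shows "fixpoints k \<rho> = fixpoints (k - 1) \<rho> + of_bool (\<rho> k = k)"
proof -
  have "{1..k} = insert k {1..k - 1}" using assms by auto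
  then have "{x \<in> {1..k}. \<rho> x = x} = {x \<in> {1..k - 1}. \<rho> x = x} \<union> (if \<rho> k = k then {k} else {})"
    by auto
  then show ?thesis using assms by (simp add: fixpoints_def)
qed

lemma fixpoints_transpose:
  assumes "i \<in> {1..<k}"
  shows "fixpoints k (transposition i k \<circ> \<rho>) + of_bool (\<rho> i = i)
       = fixpoints (k - 1) \<rho> + of_bool (\<rho> i = k) + of_bool (\<rho> k = i)"
proof -
  have "(transposition i k \<circ> \<rho>) k = k \<longleftrightarrow> \<rho> k = i"
    using assms by (subst transpose_comp_fixed_iff) auto
  then show ?thesis
    using fixpoints_transpose_below[OF assms, of \<rho>] assms
      fixpoints_split_last[of k "transposition i k \<circ> \<rho>"] by simp
qed

lemma card_fixpoints_sum:
  "(\<Sum>i\<in>{1..<k}. of_bool (\<rho> i = i)) = (of_nat (fixpoints (k - 1) \<rho>) :: complex)"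
proof -
  have "{1..<k} \<inter> {i. \<rho> i = i} = {i \<in> {1..k - 1}. \<rho> i = i}" by auto
  then show ?thesis by (simp add: fixpoints_def)
qed

section \<open>Two identities for Jucys-Murphy elements\<close>

text \<open>
  The computation shared by the two identities that follow, in which \<open>h\<close> counts the fixed points
  below \<open>k\<close>: each of the \<open>h\<close> transpositions that move a fixed point \<open>i\<close> lowers the count by one,
  the others leave it. Pascal's rule expresses the sum as
  \<open>(k - 1) * g h - h * g' (h - 1)\<close> for the values \<open>g\<close> of degree \<open>k\<close> and \<open>g'\<close> of degree \<open>k - 1\<close>, and
  the recurrence evaluates it. The permutations with \<open>\<rho> k \<noteq> k\<close> lead to small corrections, which are
  added where the lemma is applied.
\<close>

lemma ascension_value_transposition_sum:
  fixes \<rho> :: "nat \<Rightarrow> nat"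
  assumes "0 < n" "0 < k"
  defines "h \<equiv> fixpoints (k - 1) \<rho>"
  shows "(\<Sum>i\<in>{1..<k}. ascension_value n k (h - of_bool (\<rho> i = i)))
       = - (of_nat n * ascension_value n k h + ascension_value n (k - 1) h)"
proof -
  have h: "h < k" using fixpoints_le[of "k - 1" \<rho>] assms by simp
  have "ascension_value n k (h - of_bool (\<rho> i = i))
      = ascension_value n k h - of_bool (\<rho> i = i) * ascension_value n (k - 1) (h - 1)"
    if "i \<in> {1..<k}" for i
  proof (cases "\<rho> i = i")
    case True
    with that have "{i} \<subseteq> {i \<in> {1..k - 1}. \<rho> i = i}" by auto
    then have "card {i} \<le> h" unfolding h_def fixpoints_def by (intro card_mono) auto
    then obtain e where "h = Suc e" by (cases h) auto
    then show ?thesis using True assms by (simp add: ascension_value_Suc)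
  qed simp
  then have "(\<Sum>i\<in>{1..<k}. ascension_value n k (h - of_bool (\<rho> i = i)))
    = of_nat (k - 1) * ascension_value n k h
      - (\<Sum>i\<in>{1..<k}. of_bool (\<rho> i = i)) * ascension_value n (k - 1) (h - 1)"
    by (simp add: sum_subtractf sum_distrib_right del: sum_of_bool_eq)
  also have "(\<Sum>i\<in>{1..<k}. of_bool (\<rho> i = i)) = (of_nat h :: complex)"
    unfolding h_def by (rule card_fixpoints_sum)
  also have "of_nat h * ascension_value n (k - 1) (h - 1)
      = (of_nat n + of_nat (k - 1)) * ascension_value n k h + ascension_value n (k - 1) h"
  proof -
    have "n + k - 1 = n + (k - 1)" using assms(2) by simp
    then show ?thesis using ascension_value_recurrence[OF assms(1) h] by (metis of_nat_add)
  qed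
  also have "of_nat (k - 1) * ascension_value n k h
      - ((of_nat n + of_nat (k - 1)) * ascension_value n k h + ascension_value n (k - 1) h)
      = - (of_nat n * ascension_value n k h + ascension_value n (k - 1) h)"
    by (simp add: ring_distribs)
  finally show ?thesis .
qed

text \<open>
  Let \<open>J\<^sub>k\<close> be the Jucys-Murphy element, the sum of the transpositions of \<open>k\<close> with a smaller number.
  In the group algebra of \<open>S\<^sub>k\<close> the lemma says
  \<open>(n + J\<^sub>k) * as\<^sub>k\<^sub>,\<^sub>n = as\<^sub>k\<^sub>-\<^sub>1\<^sub>,\<^sub>n * (n - 1 + J\<^sub>k)\<close>, where functions on \<open>S\<^sub>k\<^sub>-\<^sub>1\<close> are extended by zero.
  It transports the relation that characterizes the Weingarten function from dimension \<open>n - 1\<close> to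
  dimension \<open>n\<close>. If \<open>\<rho>\<close> moves \<open>k\<close>, exactly one term survives in the last sum, the one for the
  preimage \<open>j\<close> of \<open>k\<close>.
\<close>

lemma ascension_jucys_murphy:
  assumes "0 < n" "0 < k" and \<rho>: "\<rho> permutes {1..k}"
  shows "of_nat n * ascension k n \<rho> + (\<Sum>i\<in>{1..<k}. ascension k n (transposition i k \<circ> \<rho>))
       = (of_nat n - 1) * (if \<rho> k = k then ascension (k - 1) n \<rho> else 0)
         + (\<Sum>i\<in>{1..<k}. if (\<rho> \<circ> transposition i k) k = k
                          then ascension (k - 1) n (\<rho> \<circ> transposition i k) else 0)"
proof -
  define h where "h = fixpoints (k - 1) \<rho>"
  let ?g = "ascension_value n k" and ?g' = "ascension_value n (k - 1)"
  note row = ascension_value_transposition_sum[OF assms(1,2), of \<rho>, folded h_def]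
  have asc: "ascension k n (transposition i k \<circ> \<rho>)
      = ?g (h + of_bool (\<rho> i = k) + of_bool (\<rho> k = i) - of_bool (\<rho> i = i))"
    if "i \<in> {1..<k}" for i
    using fixpoints_transpose[OF that, of \<rho>] unfolding ascension_eq h_def
    by (metis add_diff_cancel_right')
  note inj = permutes_inj[OF \<rho>]
  have comp: "(\<rho> \<circ> transposition i k) k = \<rho> i" for i by simp
  show ?thesis
  proof (cases "\<rho> k = k")
    case True
    have ne: "\<rho> i \<noteq> k" if "i \<in> {1..<k}" for i
    proof
      assume "\<rho> i = k" then have "i = k" using True inj by (metis injD)
      then show False using that by simp
    qed
    have "(\<Sum>i\<in>{1..<k}. ascension k n (transposition i k \<circ> \<rho>))
       = (\<Sum>i\<in>{1..<k}. ?g (h - of_bool (\<rho> i = i)))"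
      using ne True by (intro sum.cong refl) (subst asc, auto)
    also note row
    finally have lhs: "(\<Sum>i\<in>{1..<k}. ascension k n (transposition i k \<circ> \<rho>))
       = - (of_nat n * ?g h + ?g' h)" .
    have k: "ascension k n \<rho> = ?g h + ?g' h"
      using True assms by (simp add: ascension_eq fixpoints_split_last h_def ascension_value_Suc)
    have "(\<Sum>i\<in>{1..<k}. if \<rho> i = k then ascension (k - 1) n (\<rho> \<circ> transposition i k) else 0) = 0"
      using ne by (intro sum.neutral) auto
    moreover have "ascension (k - 1) n \<rho> = ?g' h" by (simp add: ascension_eq h_def)
    ultimately show ?thesis unfolding comp lhs k by (simp add: True ring_distribs)
  next
    case False
    define j where "j = inv_into UNIV \<rho> k"
    have j: "\<rho> i = k \<longleftrightarrow> i = j" for i unfolding j_def using permutes_inverses[OF \<rho>] by metis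
    have kin: "k \<in> {1..k}" using assms by simp
    have "\<rho> j = k" using j[of j] by simp
    then have "j \<in> {1..k}" "j \<noteq> k" using permutes_in_image[OF \<rho>, of j] kin False by auto
    then have jk: "j \<in> {1..<k}" by auto
    have lk: "\<rho> k \<in> {1..<k}" using permutes_in_image[OF \<rho>, of k] kin False by auto
    have moved: "i \<noteq> j \<and> i \<noteq> \<rho> k" if "\<rho> i = i" "i \<in> {1..<k}" for i
      using that j[of i] injD[OF inj, of i k] by auto
    \<comment> \<open>The two gains happen at \<open>i = j\<close> and \<open>i = \<rho> k\<close>. If these coincide, that is if \<open>k\<close> lies in
    a 2-cycle, both happen for the same \<open>i\<close>, and Pascal's rule is applied twice there; \<open>e\<close> marks
    this case.\<close>
    define e where "e = (of_bool (\<rho> k = j) :: nat)"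
    have "fixpoints (k - 1) (\<rho> \<circ> transposition j k) = h + e"
    proof -
      \<comment> \<open>Both sides cut \<open>k\<close> out of its cycle.\<close>
      have eq: "\<rho> \<circ> transposition j k = transposition (\<rho> k) k \<circ> \<rho>"
      proof
        fix x show "(\<rho> \<circ> transposition j k) x = (transposition (\<rho> k) k \<circ> \<rho>) x"
          using j[of x] j[of j] injD[OF inj, of x k] by (auto simp: Transposition.transpose_def)
      qed
      have "\<rho> (\<rho> k) \<noteq> \<rho> k" using injD[OF inj, of "\<rho> k" k] False by auto
      then show ?thesis unfolding eq using fixpoints_transpose_below[OF lk, of \<rho>] j[of "\<rho> k"]
        by (simp add: h_def e_def)
    qed
    then have "(\<Sum>i\<in>{1..<k}. if \<rho> i = k then ascension (k - 1) n (\<rho> \<circ> transposition i k) else 0)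
        = ?g' (h + e)"
      unfolding j using jk by (simp add: ascension_eq)
    moreover have "(\<Sum>i\<in>{1..<k}. ascension k n (transposition i k \<circ> \<rho>))
       = (\<Sum>i\<in>{1..<k}. ?g (h - of_bool (\<rho> i = i))) + ?g' h + ?g' (h + e)"
    proof -
      have "ascension k n (transposition i k \<circ> \<rho>)
         = ?g (h - of_bool (\<rho> i = i)) + (of_bool (i = j) * ?g' (h + e) + of_bool (i = \<rho> k) * ?g' h)"
        if i: "i \<in> {1..<k}" for i
        unfolding asc[OF i] using moved[OF _ i] j[of i] assms(2)
        by (auto simp: e_def ascension_value_Suc)
      then show ?thesis using jk lk by (simp add: sum.distrib)
    qed
    moreover have "ascension k n \<rho> = ?g h"
      using False assms by (simp add: ascension_eq fixpoints_split_last h_def)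
    ultimately show ?thesis unfolding comp row by (simp add: False)
  qed
qed

text \<open>
  The analogue for the kernel that leads from \<open>S\<^sub>n\<^sub>-\<^sub>1\<close> to \<open>S\<^sub>n\<close>. It counts only the fixed points
  below \<open>n\<close>, and up to sign \<open>n + J\<^sub>n\<close> maps it to the ascension function of \<open>S\<^sub>n\<^sub>-\<^sub>1\<close>.
\<close>

lemma descent_jucys_murphy:
  assumes "0 < n" and \<rho>: "\<rho> permutes {1..n}"
  shows "of_nat n * ascension_value n n (fixpoints (n - 1) \<rho>)
       + (\<Sum>i\<in>{1..<n}. ascension_value n n (fixpoints (n - 1) (transposition i n \<circ> \<rho>)))
       = - (if \<rho> n = n then ascension (n - 1) n \<rho> else 0)"
proof -
  define h where "h = fixpoints (n - 1) \<rho>"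
  let ?g = "ascension_value n n" and ?g' = "ascension_value n (n - 1)"
  note row = ascension_value_transposition_sum[OF assms(1) assms(1), of \<rho>, folded h_def]
  have asc: "fixpoints (n - 1) (transposition i n \<circ> \<rho>)
      = h + of_bool (\<rho> i = n) - of_bool (\<rho> i = i)"
    if "i \<in> {1..<n}" for i
    using fixpoints_transpose_below[OF that, of \<rho>] unfolding h_def by (metis add_diff_cancel_right')
  define j where "j = inv_into UNIV \<rho> n"
  have j: "\<rho> i = n \<longleftrightarrow> i = j" for i unfolding j_def using permutes_inverses[OF \<rho>] by metis
  have "\<rho> j = n" using j[of j] by simp
  then have "j \<in> {1..n}" using permutes_in_image[OF \<rho>, of j] assms(1) by auto
  have "?g (fixpoints (n - 1) (transposition i n \<circ> \<rho>))
      = ?g (h - of_bool (\<rho> i = i)) + of_bool (i = j) * ?g' h" if i: "i \<in> {1..<n}" for i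
    unfolding asc[OF i] using j[of i] i assms(1)
    by (auto simp: ascension_value_Suc)
  then have "(\<Sum>i\<in>{1..<n}. ?g (fixpoints (n - 1) (transposition i n \<circ> \<rho>)))
      = (\<Sum>i\<in>{1..<n}. ?g (h - of_bool (\<rho> i = i))) + (if j \<in> {1..<n} then ?g' h else 0)"
    by (simp add: sum.distrib)
  moreover have "j \<in> {1..<n} \<longleftrightarrow> \<rho> n \<noteq> n" using j[of n] \<open>j \<in> {1..n}\<close> by auto
  moreover have "ascension (n - 1) n \<rho> = ?g' h" by (simp add: ascension_eq h_def)
  ultimately show ?thesis unfolding row h_def[symmetric] by simp
qed

section \<open>The characterizing relation\<close>

definition perms :: "nat \<Rightarrow> (nat \<Rightarrow> nat) set" where
  "perms k = {p. p permutes {1..k}}"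

lemma finite_perms [simp]: "finite (perms k)"
  by (simp add: perms_def finite_permutations)

lemma perms_0 [simp]: "perms 0 = {id}"
  by (auto simp: perms_def)

lemma id_perms [simp]: "id \<in> perms k"
  by (simp add: perms_def permutes_id)

lemma perms_comp: "p \<in> perms k \<Longrightarrow> q \<in> perms k \<Longrightarrow> p \<circ> q \<in> perms k"
  by (auto simp: perms_def intro: permutes_compose)

lemma perms_inv: "p \<in> perms k \<Longrightarrow> inv_into UNIV p \<in> perms k"
  by (auto simp: perms_def intro: permutes_inv)

lemma transposition_perms:
  "i \<in> {1..<k} \<Longrightarrow> transposition i k \<in> perms k"
  by (auto simp: perms_def intro!: permutes_swap_id)

lemma perms_mono: "j \<le> k \<Longrightarrow> perms j \<subseteq> perms k"
  by (auto simp: perms_def intro: permutes_subset)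

lemma perms_fix_last:
  assumes "0 < k" "p \<in> perms k"
  shows "p k = k \<longleftrightarrow> p \<in> perms (k - 1)"
proof
  assume "p k = k"
  then show "p \<in> perms (k - 1)" using assms unfolding perms_def
    by (auto simp: permutes_def) (metis One_nat_def Suc_leI Suc_pred le_SucE)
next
  assume "p \<in> perms (k - 1)"
  then show "p k = k" using assms by (auto simp: perms_def permutes_def)
qed

lemma perms_inverse:
  assumes "p \<in> perms k"
  shows "p \<circ> inv_into UNIV p = id" "inv_into UNIV p \<circ> p = id"
  using assms by (auto simp: perms_def permutes_inv_o)

lemma sum_perms_left:
  assumes "p \<in> perms k"
  shows "(\<Sum>\<sigma>\<in>perms k. f (p \<circ> \<sigma>)) = (\<Sum>\<sigma>\<in>perms k. f \<sigma>)"
  using assms setum_permutations_compose_left[of p "{1..k}" f] by (simp add: perms_def)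

text \<open>
  In the group algebra: \<open>(n + J\<^sub>k) * W = X\<close>, with \<open>X\<close> extended from \<open>S\<^sub>k\<^sub>-\<^sub>1\<close> by zero. Starting from
  the constant \<open>1\<close> on \<open>S\<^sub>0\<close>, the iterated relation is Jucys' factorization
  \<open>(n + J\<^sub>1) * \<dots> * (n + J\<^sub>k)\<close> of the function that maps \<open>\<pi>\<close> to \<open>n\<close> to the number of its cycles,
  whose convolution inverse is the Weingarten function.
\<close>

definition weingarten_relation ::
  "nat \<Rightarrow> nat \<Rightarrow> ((nat \<Rightarrow> nat) \<Rightarrow> complex) \<Rightarrow> ((nat \<Rightarrow> nat) \<Rightarrow> complex) \<Rightarrow> bool" where
  "weingarten_relation n k W X \<longleftrightarrow>
     (\<forall>\<pi>\<in>perms k. of_nat n * W \<pi> + (\<Sum>i\<in>{1..<k}. W (transposition i k \<circ> \<pi>))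
        = (if \<pi> k = k then X \<pi> else 0))"

text \<open>
  Multiplication by \<open>J\<^sub>k\<close> is a sum of \<open>k - 1\<close> isometries for the supremum norm, and \<open>k - 1 < n\<close>.
\<close>

lemma jucys_murphy_injective:
  fixes D :: "(nat \<Rightarrow> nat) \<Rightarrow> complex"
  assumes "0 < k" "k \<le> n"
    and rel: "\<And>\<pi>. \<pi> \<in> perms k \<Longrightarrow> of_nat n * D \<pi> + (\<Sum>i\<in>{1..<k}. D (transposition i k \<circ> \<pi>)) = 0"
    and "\<pi> \<in> perms k"
  shows "D \<pi> = 0"
proof -
  define m where "m = Max ((norm \<circ> D) ` perms k)"
  have bound: "norm (D \<sigma>) \<le> m" if "\<sigma> \<in> perms k" for \<sigma>
    unfolding m_def using that by (intro Max_ge) auto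
  have "m \<in> (norm \<circ> D) ` perms k"
    unfolding m_def using id_perms by (intro Max_in) (auto simp del: id_perms)
  then obtain \<rho> where \<rho>: "\<rho> \<in> perms k" "m = norm (D \<rho>)" by auto
  have "of_nat n * D \<rho> = - (\<Sum>i\<in>{1..<k}. D (transposition i k \<circ> \<rho>))"
    using rel[OF \<rho>(1)] by (simp add: eq_neg_iff_add_eq_0)
  then have "of_nat n * m = norm (\<Sum>i\<in>{1..<k}. D (transposition i k \<circ> \<rho>))"
    using \<rho>(2) by (metis norm_minus_cancel norm_mult norm_of_nat)
  also have "\<dots> \<le> (\<Sum>i\<in>{1..<k}. m)"
    using \<rho>(1) by (intro sum_norm_le bound perms_comp transposition_perms)
  also have "\<dots> = real (k - 1) * m" by simp
  finally have "(real n - real (k - 1)) * m \<le> 0" by (simp add: algebra_simps)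
  moreover have "real n - real (k - 1) > 0" using assms by simp
  ultimately have "m \<le> 0" by (simp add: mult_le_0_iff)
  then show ?thesis using bound[OF assms(4)] by (metis norm_le_zero_iff order_trans)
qed

lemma weingarten_relation_unique:
  assumes "0 < k" "k \<le> n" "weingarten_relation n k W X" "weingarten_relation n k W' X'"
    and XX: "\<And>\<sigma>. \<sigma> \<in> perms (k - 1) \<Longrightarrow> X \<sigma> = X' \<sigma>"
    and "\<pi> \<in> perms k"
  shows "W \<pi> = W' \<pi>"
proof -
  have "W \<pi> - W' \<pi> = 0"
  proof (rule jucys_murphy_injective[where D = "\<lambda>\<pi>. W \<pi> - W' \<pi>", OF assms(1,2) _ assms(6)])
    fix \<rho> assume \<rho>: "\<rho> \<in> perms k"
    have "X \<rho> = X' \<rho>" if "\<rho> k = k" using XX perms_fix_last[OF assms(1) \<rho>] that by simp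
    then have "of_nat n * W \<rho> + (\<Sum>i\<in>{1..<k}. W (transposition i k \<circ> \<rho>))
        = of_nat n * W' \<rho> + (\<Sum>i\<in>{1..<k}. W' (transposition i k \<circ> \<rho>))"
      using assms(3,4) \<rho> by (simp add: weingarten_relation_def)
    then show "of_nat n * (W \<rho> - W' \<rho>)
        + (\<Sum>i\<in>{1..<k}. W (transposition i k \<circ> \<rho>) - W' (transposition i k \<circ> \<rho>)) = 0"
      by (simp add: algebra_simps sum_subtractf)
  qed
  then show ?thesis by simp
qed

text \<open>
  The element \<open>J\<^sub>k\<close> commutes with functions on \<open>S\<^sub>k\<^sub>-\<^sub>1\<close>. On each side at most one summand is not zero,
  and both of these evaluate \<open>X\<close> at the permutation obtained by cutting \<open>k\<close> out of its cycle in \<open>\<pi>\<close>.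
\<close>

lemma sum_transposition_commute:
  assumes "0 < k" and \<pi>: "\<pi> \<in> perms k"
  shows "(\<Sum>i\<in>{1..<k}. if (transposition i k \<circ> \<pi>) k = k then X (transposition i k \<circ> \<pi>) else 0)
       = (\<Sum>i\<in>{1..<k}. if (\<pi> \<circ> transposition i k) k = k then X (\<pi> \<circ> transposition i k) else (0::complex))"
proof -
  have p: "\<pi> permutes {1..k}" using \<pi> by (simp add: perms_def)
  note inj = permutes_inj[OF p]
  define j where "j = inv_into UNIV \<pi> k"
  have j: "\<pi> i = k \<longleftrightarrow> i = j" for i unfolding j_def using permutes_inverses[OF p] by metis
  have pj: "\<pi> j = k" using j by simp
  have L: "(transposition i k \<circ> \<pi>) k = k \<longleftrightarrow> i = \<pi> k" if "i \<in> {1..<k}" for i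
    using that by (auto simp: Transposition.transpose_def)
  have R: "(\<pi> \<circ> transposition i k) k = k \<longleftrightarrow> i = j" for i
    by (simp add: j)
  have kin: "k \<in> {1..k}" using assms by simp
  have eq: "transposition (\<pi> k) k \<circ> \<pi> = \<pi> \<circ> transposition j k"
  proof
    fix x show "(transposition (\<pi> k) k \<circ> \<pi>) x = (\<pi> \<circ> transposition j k) x"
      using j[of x] pj injD[OF inj, of x k] by (auto simp: Transposition.transpose_def)
  qed
  have mem: "\<pi> k \<in> {1..<k} \<longleftrightarrow> j \<in> {1..<k}"
    using permutes_in_image[OF p, of k] permutes_in_image[OF p, of j] kin pj j[of k] by auto
  have "(\<Sum>i\<in>{1..<k}. if (transposition i k \<circ> \<pi>) k = k then X (transposition i k \<circ> \<pi>) else 0)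
      = (\<Sum>i\<in>{1..<k}. if i = \<pi> k then X (transposition (\<pi> k) k \<circ> \<pi>) else 0)"
    by (intro sum.cong refl) (simp only: L split: if_split, simp)
  moreover have "(\<Sum>i\<in>{1..<k}. if (\<pi> \<circ> transposition i k) k = k then X (\<pi> \<circ> transposition i k) else 0)
      = (\<Sum>i\<in>{1..<k}. if i = j then X (\<pi> \<circ> transposition j k) else 0)"
    by (intro sum.cong refl) (simp only: R split: if_split, simp)
  ultimately show ?thesis using mem unfolding eq by (simp del: o_apply)
qed

lemma inverse_transposition_comp:
  assumes "\<pi> \<in> perms k" "i \<in> {1..<k}"
  shows "inv_into UNIV (transposition i k \<circ> \<pi>) = inv_into UNIV \<pi> \<circ> transposition i k"
  using assms o_inv_distrib[of "transposition i k" \<pi>]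
  by (simp add: perms_def permutes_bij)

text \<open>
  Since \<open>J\<^sub>k\<close> commutes with \<open>X\<close>, the commutator \<open>D\<close> of \<open>J\<^sub>k\<close> and \<open>W\<close> satisfies \<open>(n + J\<^sub>k) * D = 0\<close>, so
  it vanishes. Hence \<open>W\<close> satisfies the relation with multiplication from the right as well, and
  inversion turns this into the original relation for \<open>W\<close> composed with inversion. Uniqueness
  concludes.
\<close>

lemma weingarten_relation_inverse:
  assumes "0 < k" "k \<le> n" and rel: "weingarten_relation n k W X"
    and X: "\<And>\<sigma>. \<sigma> \<in> perms (k - 1) \<Longrightarrow> X (inv_into UNIV \<sigma>) = X \<sigma>"
    and "\<pi> \<in> perms k"
  shows "W (inv_into UNIV \<pi>) = W \<pi>"
proof -
  let ?\<tau> = "\<lambda>i. transposition i k"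
  let ?X = "\<lambda>\<pi>. if \<pi> k = k then X \<pi> else 0"
  have relD: "of_nat n * W \<pi> + (\<Sum>i\<in>{1..<k}. W (?\<tau> i \<circ> \<pi>)) = ?X \<pi>" if "\<pi> \<in> perms k" for \<pi>
    using rel that by (simp add: weingarten_relation_def)
  define D where "D \<pi> = (\<Sum>i\<in>{1..<k}. W (?\<tau> i \<circ> \<pi>)) - (\<Sum>i\<in>{1..<k}. W (\<pi> \<circ> ?\<tau> i))" for \<pi>
  have D: "D \<rho> = 0" if \<rho>: "\<rho> \<in> perms k" for \<rho>
  proof (rule jucys_murphy_injective[OF assms(1,2) _ \<rho>])
    fix \<pi> assume \<pi>: "\<pi> \<in> perms k"
    have "of_nat n * D \<pi> + (\<Sum>j\<in>{1..<k}. D (?\<tau> j \<circ> \<pi>))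
      = (\<Sum>i\<in>{1..<k}. of_nat n * W (?\<tau> i \<circ> \<pi>) + (\<Sum>j\<in>{1..<k}. W (?\<tau> j \<circ> (?\<tau> i \<circ> \<pi>))))
      - (\<Sum>i\<in>{1..<k}. of_nat n * W (\<pi> \<circ> ?\<tau> i) + (\<Sum>j\<in>{1..<k}. W (?\<tau> j \<circ> (\<pi> \<circ> ?\<tau> i))))"
    proof -
      have "(\<Sum>j\<in>{1..<k}. \<Sum>i\<in>{1..<k}. W (?\<tau> i \<circ> (?\<tau> j \<circ> \<pi>)))
          = (\<Sum>i\<in>{1..<k}. \<Sum>j\<in>{1..<k}. W (?\<tau> j \<circ> (?\<tau> i \<circ> \<pi>)))" by simp
      moreover have "(\<Sum>j\<in>{1..<k}. \<Sum>i\<in>{1..<k}. W ((?\<tau> j \<circ> \<pi>) \<circ> ?\<tau> i))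
          = (\<Sum>i\<in>{1..<k}. \<Sum>j\<in>{1..<k}. W (?\<tau> j \<circ> (\<pi> \<circ> ?\<tau> i)))"
        by (subst sum.swap) (simp add: comp_assoc)
      ultimately show ?thesis unfolding D_def
        by (simp add: sum_subtractf sum.distrib right_diff_distrib sum_distrib_left del: o_apply)
    qed
    also have "\<dots> = (\<Sum>i\<in>{1..<k}. ?X (?\<tau> i \<circ> \<pi>)) - (\<Sum>i\<in>{1..<k}. ?X (\<pi> \<circ> ?\<tau> i))"
      using \<pi> by (intro arg_cong2[where f = minus] sum.cong refl relD perms_comp transposition_perms)
    also have "\<dots> = 0" using sum_transposition_commute[OF assms(1) \<pi>, of X] by simp
    finally show "of_nat n * D \<pi> + (\<Sum>j\<in>{1..<k}. D (?\<tau> j \<circ> \<pi>)) = 0" .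
  qed
  have "weingarten_relation n k (\<lambda>\<pi>. W (inv_into UNIV \<pi>)) X"
    unfolding weingarten_relation_def
  proof
    fix \<pi> assume \<pi>: "\<pi> \<in> perms k"
    let ?q = "inv_into UNIV \<pi>"
    have q: "?q \<in> perms k" using \<pi> by (rule perms_inv)
    have "(\<Sum>i\<in>{1..<k}. W (inv_into UNIV (?\<tau> i \<circ> \<pi>))) = (\<Sum>i\<in>{1..<k}. W (?q \<circ> ?\<tau> i))"
      using \<pi> by (intro sum.cong refl arg_cong[where f = W] inverse_transposition_comp)
    also have "\<dots> = (\<Sum>i\<in>{1..<k}. W (?\<tau> i \<circ> ?q))" using D[OF q] by (simp add: D_def)
    also have "of_nat n * W ?q + \<dots> = ?X ?q" using relD[OF q] .
    also have "?q k = k \<longleftrightarrow> \<pi> k = k" using \<pi> by (simp add: perms_def permutes_inv_eq)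
    also have "(if \<pi> k = k then X ?q else 0) = ?X \<pi>"
      using X perms_fix_last[OF assms(1) \<pi>] by simp
    finally show "of_nat n * W ?q + (\<Sum>i\<in>{1..<k}. W (inv_into UNIV (?\<tau> i \<circ> \<pi>))) = ?X \<pi>" .
  qed
  from weingarten_relation_unique[OF assms(1,2) this rel refl assms(5)] show ?thesis .
qed

section \<open>Kernels that preserve the relation\<close>

text \<open>
  Convolution with the ascension function raises the dimension by one: \<open>n + 1 + J\<^sub>k\<close> passes
  \<open>as\<^sub>k\<close>, turning it into \<open>as\<^sub>k\<^sub>-\<^sub>1\<close>, and arrives at \<open>W\<close> as \<open>n + J\<^sub>k\<close>, where the hypothesis replaces it
  by \<open>X\<close>.
\<close>

lemma weingarten_relation_ascension:
  assumes "0 < k" and rel: "weingarten_relation n k W X"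
  shows "weingarten_relation (Suc n) k
           (\<lambda>\<pi>. \<Sum>\<sigma>\<in>perms k. ascension k (Suc n) (\<pi> \<circ> inv_into UNIV \<sigma>) * W \<sigma>)
           (\<lambda>\<pi>. \<Sum>\<sigma>\<in>perms (k - 1). ascension (k - 1) (Suc n) (\<pi> \<circ> inv_into UNIV \<sigma>) * X \<sigma>)"
  unfolding weingarten_relation_def
proof
  fix \<pi> assume \<pi>: "\<pi> \<in> perms k"
  let ?\<tau> = "\<lambda>i. transposition i k" and ?inv = "inv_into UNIV :: (nat \<Rightarrow> nat) \<Rightarrow> _"
  let ?as = "ascension k (Suc n)"
  define A where "A \<rho> = (if \<rho> k = k then ascension (k - 1) (Suc n) \<rho> else 0)" for \<rho>
  have as: "of_nat (Suc n) * ?as \<rho> + (\<Sum>i\<in>{1..<k}. ?as (?\<tau> i \<circ> \<rho>))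
      = of_nat n * A \<rho> + (\<Sum>i\<in>{1..<k}. A (\<rho> \<circ> ?\<tau> i))" if "\<rho> \<in> perms k" for \<rho>
    using ascension_jucys_murphy[of "Suc n" k \<rho>] that assms(1)
    unfolding A_def by (simp add: perms_def)
  \<comment> \<open>The substitution \<open>\<sigma> \<mapsto> \<tau> i \<circ> \<sigma>\<close> moves the transposition from the kernel to \<open>W\<close>.\<close>
  have shift: "(\<Sum>\<sigma>\<in>perms k. A (\<pi> \<circ> ?inv \<sigma> \<circ> ?\<tau> i) * W \<sigma>)
      = (\<Sum>\<sigma>\<in>perms k. A (\<pi> \<circ> ?inv \<sigma>) * W (?\<tau> i \<circ> \<sigma>))" if i: "i \<in> {1..<k}" for i
  proof -
    have "\<pi> \<circ> ?inv (?\<tau> i \<circ> \<sigma>) \<circ> ?\<tau> i = \<pi> \<circ> ?inv \<sigma>" if "\<sigma> \<in> perms k" for \<sigma>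
      unfolding inverse_transposition_comp[OF that i] by (simp add: comp_assoc)
    then show ?thesis
      by (subst sum_perms_left[OF transposition_perms[OF i], symmetric]) (simp del: o_apply)
  qed
  have "of_nat (Suc n) * (\<Sum>\<sigma>\<in>perms k. ?as (\<pi> \<circ> ?inv \<sigma>) * W \<sigma>)
      + (\<Sum>i\<in>{1..<k}. \<Sum>\<sigma>\<in>perms k. ?as (?\<tau> i \<circ> \<pi> \<circ> ?inv \<sigma>) * W \<sigma>)
      = (\<Sum>\<sigma>\<in>perms k. (of_nat (Suc n) * ?as (\<pi> \<circ> ?inv \<sigma>)
          + (\<Sum>i\<in>{1..<k}. ?as (?\<tau> i \<circ> (\<pi> \<circ> ?inv \<sigma>)))) * W \<sigma>)"
    by (subst sum.swap)
       (simp add: sum.distrib sum_distrib_left sum_distrib_right distrib_right mult.assoc comp_assoc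
          del: o_apply of_nat_Suc)
  also have "\<dots> = (\<Sum>\<sigma>\<in>perms k. (of_nat n * A (\<pi> \<circ> ?inv \<sigma>)
          + (\<Sum>i\<in>{1..<k}. A (\<pi> \<circ> ?inv \<sigma> \<circ> ?\<tau> i))) * W \<sigma>)"
    using \<pi> by (intro sum.cong refl arg_cong2[where f = times] as perms_comp perms_inv)
  also have "\<dots> = of_nat n * (\<Sum>\<sigma>\<in>perms k. A (\<pi> \<circ> ?inv \<sigma>) * W \<sigma>)
          + (\<Sum>i\<in>{1..<k}. \<Sum>\<sigma>\<in>perms k. A (\<pi> \<circ> ?inv \<sigma> \<circ> ?\<tau> i) * W \<sigma>)"
    by (subst sum.swap)
       (simp add: sum.distrib sum_distrib_left sum_distrib_right distrib_right mult.assoc del: o_apply)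
  also have "\<dots> = of_nat n * (\<Sum>\<sigma>\<in>perms k. A (\<pi> \<circ> ?inv \<sigma>) * W \<sigma>)
          + (\<Sum>i\<in>{1..<k}. \<Sum>\<sigma>\<in>perms k. A (\<pi> \<circ> ?inv \<sigma>) * W (?\<tau> i \<circ> \<sigma>))"
    by (intro arg_cong2[where f = plus] sum.cong refl shift)
  also have "\<dots> = (\<Sum>\<sigma>\<in>perms k. A (\<pi> \<circ> ?inv \<sigma>)
          * (of_nat n * W \<sigma> + (\<Sum>i\<in>{1..<k}. W (?\<tau> i \<circ> \<sigma>))))"
    by (subst sum.swap)
       (simp add: sum.distrib sum_distrib_left distrib_left mult.left_commute del: o_apply)
  also have "\<dots> = (\<Sum>\<sigma>\<in>perms k. A (\<pi> \<circ> ?inv \<sigma>) * (if \<sigma> k = k then X \<sigma> else 0))"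
    using rel by (simp add: weingarten_relation_def del: o_apply)
  also have "\<dots> = (\<Sum>\<sigma>\<in>perms (k - 1). A (\<pi> \<circ> ?inv \<sigma>) * X \<sigma>)"
    using perms_fix_last[OF assms(1)] perms_mono[of "k - 1" k] 
    by (intro sum.mono_neutral_cong_right) auto
  also have "\<dots> = (if \<pi> k = k then (\<Sum>\<sigma>\<in>perms (k - 1).
          ascension (k - 1) (Suc n) (\<pi> \<circ> ?inv \<sigma>) * X \<sigma>) else 0)"
  proof -
    have "?inv \<sigma> k = k" if "\<sigma> \<in> perms (k - 1)" for \<sigma>
      using perms_inv[OF that] assms(1) by (auto simp: perms_def permutes_def)
    then show ?thesis by (simp add: A_def)
  qed
  finally show "of_nat (Suc n) * (\<Sum>\<sigma>\<in>perms k. ?as (\<pi> \<circ> ?inv \<sigma>) * W \<sigma>)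
      + (\<Sum>i\<in>{1..<k}. \<Sum>\<sigma>\<in>perms k. ?as (?\<tau> i \<circ> \<pi> \<circ> ?inv \<sigma>) * W \<sigma>)
    = (if \<pi> k = k then (\<Sum>\<sigma>\<in>perms (k - 1).
          ascension (k - 1) (Suc n) (\<pi> \<circ> ?inv \<sigma>) * X \<sigma>) else 0)" .
qed

text \<open>
  In the square case \<open>k\<close> and the dimension grow together, from \<open>n\<close> to \<open>n + 1\<close>. The kernel
  depends on \<open>\<pi> \<circ> \<tau>\<close> and the ascension function on \<open>\<pi> \<circ> \<sigma>\<^sup>-\<^sup>1\<close>, which is why \<open>X\<close> has to be
  invariant under inversion.
\<close>

lemma weingarten_relation_descent:
  assumes X: "\<And>\<sigma>. \<sigma> \<in> perms n \<Longrightarrow> X (inv_into UNIV \<sigma>) = X \<sigma>"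
  shows "weingarten_relation (Suc n) (Suc n)
           (\<lambda>\<pi>. \<Sum>\<tau>\<in>perms n. a_fun (Suc n) \<pi> \<tau> * X \<tau>)
           (\<lambda>\<pi>. \<Sum>\<sigma>\<in>perms n. ascension n (Suc n) (\<pi> \<circ> inv_into UNIV \<sigma>) * X \<sigma>)"
  unfolding weingarten_relation_def
proof
  fix \<pi> assume \<pi>: "\<pi> \<in> perms (Suc n)"
  let ?\<tau> = "\<lambda>i. transposition i (Suc n)" and ?inv = "inv_into UNIV :: (nat \<Rightarrow> nat) \<Rightarrow> _"
  let ?b = "\<lambda>\<rho>. - ascension_value (Suc n) (Suc n) (fixpoints n \<rho>)"
  have a: "a_fun (Suc n) \<rho> \<tau> = ?b (\<rho> \<circ> \<tau>)" for \<rho> \<tau>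
    by (simp add: a_fun_eq fixpoints2_def fixpoints_def)
  have b: "of_nat (Suc n) * ?b \<rho> + (\<Sum>i\<in>{1..<Suc n}. ?b (?\<tau> i \<circ> \<rho>))
      = (if \<rho> (Suc n) = Suc n then ascension n (Suc n) \<rho> else 0)" if "\<rho> \<in> perms (Suc n)" for \<rho>
  proof -
    have "of_nat (Suc n) * ?b \<rho> + (\<Sum>i\<in>{1..<Suc n}. ?b (?\<tau> i \<circ> \<rho>))
      = - (of_nat (Suc n) * ascension_value (Suc n) (Suc n) (fixpoints n \<rho>)
         + (\<Sum>i\<in>{1..<Suc n}. ascension_value (Suc n) (Suc n) (fixpoints n (?\<tau> i \<circ> \<rho>))))"
      by (simp only: sum_negf minus_add_distrib mult_minus_right)
    also have "of_nat (Suc n) * ascension_value (Suc n) (Suc n) (fixpoints n \<rho>)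
         + (\<Sum>i\<in>{1..<Suc n}. ascension_value (Suc n) (Suc n) (fixpoints n (?\<tau> i \<circ> \<rho>)))
        = - (if \<rho> (Suc n) = Suc n then ascension n (Suc n) \<rho> else 0)"
      using that descent_jucys_murphy[of "Suc n" \<rho>, unfolded diff_Suc_1]
      unfolding perms_def by blast
    finally show ?thesis by (simp only: minus_minus)
  qed
  have "of_nat (Suc n) * (\<Sum>\<tau>\<in>perms n. a_fun (Suc n) \<pi> \<tau> * X \<tau>)
      + (\<Sum>i\<in>{1..<Suc n}. \<Sum>\<tau>\<in>perms n. a_fun (Suc n) (?\<tau> i \<circ> \<pi>) \<tau> * X \<tau>)
      = (\<Sum>\<tau>\<in>perms n. (of_nat (Suc n) * ?b (\<pi> \<circ> \<tau>)
          + (\<Sum>i\<in>{1..<Suc n}. ?b (?\<tau> i \<circ> (\<pi> \<circ> \<tau>)))) * X \<tau>)"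
    unfolding a comp_assoc
    by (subst sum.swap)
       (simp only: sum.distrib sum_distrib_left sum_distrib_right distrib_right mult.assoc)
  also have "\<dots> = (\<Sum>\<tau>\<in>perms n. (if (\<pi> \<circ> \<tau>) (Suc n) = Suc n then ascension n (Suc n) (\<pi> \<circ> \<tau>) else 0) * X \<tau>)"
    using \<pi> perms_mono[of n "Suc n"]
    by (intro sum.cong refl arg_cong2[where f = times] b perms_comp) auto
  also have "\<dots> = (if \<pi> (Suc n) = Suc n then \<Sum>\<tau>\<in>perms n. ascension n (Suc n) (\<pi> \<circ> \<tau>) * X \<tau> else 0)"
  proof -
    have "(\<pi> \<circ> \<tau>) (Suc n) = \<pi> (Suc n)" if "\<tau> \<in> perms n" for \<tau>
      using that by (auto simp: perms_def permutes_def)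
    then show ?thesis
      by (cases "\<pi> (Suc n) = Suc n") (simp_all del: o_apply)
  qed
  also have "(\<Sum>\<tau>\<in>perms n. ascension n (Suc n) (\<pi> \<circ> \<tau>) * X \<tau>)
      = (\<Sum>\<tau>\<in>perms n. ascension n (Suc n) (\<pi> \<circ> ?inv \<tau>) * X (?inv \<tau>))"
    unfolding perms_def by (rule sum_permutations_inverse)
  also have "\<dots> = (\<Sum>\<tau>\<in>perms n. ascension n (Suc n) (\<pi> \<circ> ?inv \<tau>) * X \<tau>)"
    by (simp add: X)
  finally show "of_nat (Suc n) * (\<Sum>\<tau>\<in>perms n. a_fun (Suc n) \<pi> \<tau> * X \<tau>)
      + (\<Sum>i\<in>{1..<Suc n}. \<Sum>\<tau>\<in>perms n. a_fun (Suc n) (?\<tau> i \<circ> \<pi>) \<tau> * X \<tau>)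
      = (if \<pi> (Suc n) = Suc n
         then \<Sum>\<tau>\<in>perms n. ascension n (Suc n) (\<pi> \<circ> ?inv \<tau>) * X \<tau> else 0)" .
qed

text \<open>
  The recursion that the theorem unrolls: \<open>ascension_chain k d\<close> stands for the Weingarten function
  of \<open>S\<^sub>k\<close> in dimension \<open>k + d\<close>. It starts from \<open>S\<^sub>0\<close>, so that the square case of \<open>S\<^sub>1\<close> needs no
  separate treatment.
\<close>

primrec descent_chain :: "nat \<Rightarrow> (nat \<Rightarrow> nat) \<Rightarrow> complex" where
  "descent_chain 0 \<pi> = 1"
| "descent_chain (Suc k) \<pi> = (\<Sum>\<tau>\<in>perms k. a_fun (Suc k) \<pi> \<tau> * descent_chain k \<tau>)"

primrec ascension_chain :: "nat \<Rightarrow> nat \<Rightarrow> (nat \<Rightarrow> nat) \<Rightarrow> complex" where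
  "ascension_chain k 0 \<pi> = descent_chain k \<pi>"
| "ascension_chain k (Suc d) \<pi> =
     (\<Sum>\<sigma>\<in>perms k. ascension k (k + Suc d) (\<pi> \<circ> inv_into UNIV \<sigma>) * ascension_chain k d \<sigma>)"

lemma ascension_chain_0: "ascension_chain 0 d \<pi> = 1"
  by (induction d arbitrary: \<pi>) (simp_all add: ascension_def fixpoints_def)

text \<open>
  By induction on the dimension. For \<open>k\<close> up to the old dimension the ascension kernel applies. For
  \<open>k\<close> equal to the new dimension the descent kernel applies; the invariance under inversion it
  requires follows from the relations for all \<open>j\<close> in the old dimension.
\<close>

lemma ascension_chain_relation:
  assumes "0 < k" "k \<le> n"
  shows "weingarten_relation n k (ascension_chain k (n - k)) (ascension_chain (k - 1) (n - (k - 1)))"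
  using assms
proof (induction n arbitrary: k)
  case (Suc n)
  note below = Suc.IH
  have step: "ascension_chain j (Suc n - j) = (\<lambda>\<pi>. \<Sum>\<sigma>\<in>perms j.
      ascension j (Suc n) (\<pi> \<circ> inv_into UNIV \<sigma>) * ascension_chain j (n - j) \<sigma>)" if "j \<le> n" for j
  proof -
    have "Suc n - j = Suc (n - j)" "j + Suc (n - j) = Suc n" using that by auto
    then show ?thesis by (simp only: fun_eq_iff ascension_chain.simps) simp
  qed
  show ?case
  proof (cases "k \<le> n")
    case True
    have "k - 1 \<le> n" using True by simp
    with weingarten_relation_ascension[OF Suc.prems(1) Suc.IH[OF Suc.prems(1) True]]
    show ?thesis using step[OF True] step[of "k - 1"] by simp
  next
    case False
    then have k: "k = Suc n" using Suc.prems by simp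
    have sym: "ascension_chain j (n - j) (inv_into UNIV \<sigma>) = ascension_chain j (n - j) \<sigma>"
      if "j \<le> n" "\<sigma> \<in> perms j" for j \<sigma>
      using that
    proof (induction j arbitrary: \<sigma>)
      case (Suc j)
      have rel: "weingarten_relation n (Suc j) (ascension_chain (Suc j) (n - Suc j))
              (ascension_chain j (n - j))"
        using below[of "Suc j"] Suc.prems(1) by simp
      have "ascension_chain j (n - j) (inv_into UNIV \<tau>) = ascension_chain j (n - j) \<tau>"
        if "\<tau> \<in> perms (Suc j - 1)" for \<tau>
        using Suc.IH[of \<tau>] Suc.prems(1) that by simp
      then show ?case
        by (rule weingarten_relation_inverse[OF zero_less_Suc Suc.prems(1) rel _ Suc.prems(2)])
    next
      case 0 then show ?case by (simp add: ascension_chain_0)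
    qed
    have "descent_chain n (inv_into UNIV \<sigma>) = descent_chain n \<sigma>" if "\<sigma> \<in> perms n" for \<sigma>
      using sym[of n] that by simp
    from weingarten_relation_descent[where X = "descent_chain n", OF this] show ?thesis
      unfolding k using step[of n]
      by (simp add: fun_eq_iff weingarten_relation_def)
  qed
qed simp

section \<open>Unrolling the recursion into a sum over sequences\<close>

text \<open>
  Both blocks of the sum in the theorem have this form: the \<open>\<sigma>\<close> with the ascension functions as
  kernels \<open>F\<close>, the \<open>\<tau>\<close> with \<open>a_fun\<close>. The weight \<open>h\<close> collects what follows below index \<open>k\<close>.
\<close>

definition path_sum ::
  "(nat \<Rightarrow> 'a set) \<Rightarrow> (nat \<Rightarrow> 'a \<Rightarrow> 'a \<Rightarrow> complex) \<Rightarrow> ('a \<Rightarrow> complex) \<Rightarrow> nat \<Rightarrow> nat \<Rightarrow> 'a \<Rightarrow> complex" where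
  "path_sum A F h k n x =
     (\<Sum>\<sigma>\<in>PiE {k..<n} A. let \<sigma>' = \<sigma>(n := x) in
        (\<Prod>m=k+1..n. F m (\<sigma>' m) (\<sigma>' (m - 1))) * h (\<sigma>' k))"

lemma path_sum_refl: "path_sum A F h k k x = h x"
  by (simp add: path_sum_def)

lemma path_sum_Suc:
  assumes "k \<le> n"
  shows "path_sum A F h k (Suc n) x = (\<Sum>y\<in>A n. F (Suc n) x y * path_sum A F h k n y)"
proof -
  define t where "t n \<sigma>' = (\<Prod>m=k+1..n. F m (\<sigma>' m) (\<sigma>' (m - 1))) * h (\<sigma>' k)"
    for n and \<sigma>' :: "nat \<Rightarrow> 'a"
  have S: "{k..<Suc n} = insert n {k..<n}" using assms by auto
  have t: "t (Suc n) (g(n := y, Suc n := x)) = F (Suc n) x y * t n (g(n := y))" for g y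
  proof -
    have "(\<Prod>m=k+1..n. F m ((g(n := y, Suc n := x)) m) ((g(n := y, Suc n := x)) (m - 1)))
        = (\<Prod>m=k+1..n. F m ((g(n := y)) m) ((g(n := y)) (m - 1)))"
      by (intro prod.cong) auto
    then show ?thesis unfolding t_def using assms by simp
  qed
  have "path_sum A F h k (Suc n) x = (\<Sum>\<sigma>\<in>PiE {k..<Suc n} A. t (Suc n) (\<sigma>(Suc n := x)))"
    unfolding path_sum_def t_def Let_def ..
  also have "\<dots> = (\<Sum>(y, g)\<in>A n \<times> PiE {k..<n} A. t (Suc n) (g(n := y, Suc n := x)))"
    unfolding S PiE_insert_eq by (subst sum.reindex[OF inj_combinator]) (auto simp: case_prod_unfold)
  also have "\<dots> = (\<Sum>y\<in>A n. \<Sum>g\<in>PiE {k..<n} A. F (Suc n) x y * t n (g(n := y)))"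
    by (simp only: t sum.cartesian_product)
  also have "\<dots> = (\<Sum>y\<in>A n. F (Suc n) x y * path_sum A F h k n y)"
    by (simp add: path_sum_def t_def Let_def sum_distrib_left)
  finally show ?thesis .
qed

lemma ascension_chain_path_sum:
  "ascension_chain k d \<pi>
     = path_sum (\<lambda>_. perms k) (\<lambda>m p q. ascension k m (p \<circ> inv_into UNIV q)) (descent_chain k) k (k + d) \<pi>"
  by (induction d arbitrary: \<pi>) (simp_all add: path_sum_refl path_sum_Suc)

lemma perms_1 [simp]: "perms (Suc 0) = {id}"
  by (auto simp: perms_def)

lemma descent_chain_1: "descent_chain (Suc 0) \<pi> = 1"
  by (simp add: a_fun_def fixpoints2_def)

text \<open>
  The sequences start at index \<open>2\<close>: as \<open>S\<^sub>1\<close> is trivial, the last kernel \<open>a_fun 2\<close> has a fixed second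
  argument and serves as the weight at the end of the path.
\<close>

lemma descent_chain_path_sum:
  "descent_chain (2 + d) \<pi> = path_sum perms a_fun (\<lambda>\<tau>. a_fun 2 \<tau> id) 2 (2 + d) \<pi>"
proof (induction d arbitrary: \<pi>)
  case 0
  have "descent_chain (Suc (Suc 0)) \<pi> = a_fun 2 \<pi> id"
    by (subst descent_chain.simps) (simp add: descent_chain_1 numeral_2_eq_2 del: descent_chain.simps)
  then show ?case by (simp add: path_sum_refl numeral_2_eq_2 id_def del: descent_chain.simps)
next
  case (Suc d)
  have "descent_chain (Suc (2 + d)) \<pi> = (\<Sum>\<tau>\<in>perms (2 + d). a_fun (Suc (2 + d)) \<pi> \<tau> * descent_chain (2 + d) \<tau>)"
    by (rule descent_chain.simps(2))
  also have "\<dots> = path_sum perms a_fun (\<lambda>\<tau>. a_fun 2 \<tau> id) 2 (Suc (2 + d)) \<pi>"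
    unfolding Suc by (rule path_sum_Suc[symmetric]) simp
  finally show ?case by (simp only: add_Suc_right)
qed

lemma descent_chain_eq_sum:
  assumes "0 < k"
  shows "descent_chain k \<pi> = (\<Sum>\<tau>\<in>(\<Pi>\<^sub>E j\<in>{2..<k}. perms j).
           let \<tau>' = \<tau>(k := \<pi>, 1 := id) in \<Prod>j=2..k. a_fun j (\<tau>' j) (\<tau>' (j - 1)))"
proof (cases "k = 1")
  case True
  then show ?thesis by (simp add: descent_chain_1 del: descent_chain.simps)
next
  case False
  then have "k = 2 + (k - 2)" using assms by simp
  then obtain d where k: "k = 2 + d" by blast
  have split: "{2..k} = insert 2 {2 + 1..k}" using k by auto
  have "(\<Prod>j=2..k. a_fun j ((\<tau>(k := \<pi>, 1 := id)) j) ((\<tau>(k := \<pi>, 1 := id)) (j - 1)))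
      = (\<Prod>m=2+1..k. a_fun m ((\<tau>(k := \<pi>)) m) ((\<tau>(k := \<pi>)) (m - 1))) * a_fun 2 ((\<tau>(k := \<pi>)) 2) id"
    for \<tau>
  proof -
    have "(\<Prod>j=2+1..k. a_fun j ((\<tau>(k := \<pi>, 1 := id)) j) ((\<tau>(k := \<pi>, 1 := id)) (j - 1)))
        = (\<Prod>m=2+1..k. a_fun m ((\<tau>(k := \<pi>)) m) ((\<tau>(k := \<pi>)) (m - 1)))"
      by (intro prod.cong) auto
    then show ?thesis unfolding split by (subst prod.insert) simp_all
  qed
  then show ?thesis unfolding descent_chain_path_sum k path_sum_def Let_def by simp
qed

lemma ascension_chain_eq_sum:
  assumes "0 < k" "k \<le> n"
  shows "ascension_chain k (n - k) \<pi> =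
    (\<Sum>(\<sigma>, \<tau>) \<in> (\<Pi>\<^sub>E m\<in>{k..<n}. {p. p permutes {1..k}}) \<times> (\<Pi>\<^sub>E j\<in>{2..<k}. {p. p permutes {1..j}}).
       let \<sigma>' = \<sigma>(n := \<pi>); \<tau>' = \<tau>(k := \<sigma>' k, 1 := id) in
         (\<Prod>m=k+1..n. ascension k m (\<sigma>' m \<circ> inv_into UNIV (\<sigma>' (m - 1)))) *
         (\<Prod>j=2..k. a_fun j (\<tau>' j) (\<tau>' (j - 1))))"
  using assms ascension_chain_path_sum[of k "n - k" \<pi>]
  by (simp add: path_sum_def descent_chain_eq_sum Let_def sum_distrib_left perms_def
        sum.cartesian_product del: One_nat_def)

section \<open>Unitary matrices\<close>

text \<open>
  Rows and columns are numbered from \<open>1\<close>, in accordance with permutations of \<open>{1..n}\<close>.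
  A matrix acting on rows is given by its coefficients in the same numbering.
\<close>

definition entry :: "complex mat \<Rightarrow> nat \<Rightarrow> nat \<Rightarrow> complex" where
  "entry U x y = U $$ (x - 1, y - 1)"

definition row_matrix :: "nat \<Rightarrow> (nat \<Rightarrow> nat \<Rightarrow> complex) \<Rightarrow> complex mat" where
  "row_matrix n T = mat n n (\<lambda>(i, j). T (Suc i) (Suc j))"

lemma sum_shift_index:
  fixes f :: "nat \<Rightarrow> 'a::comm_monoid_add"
  shows "(\<Sum>i\<in>{0..<n}. f (Suc i)) = (\<Sum>x\<in>{1..n}. f x)"
  by (rule sum.reindex_bij_witness[of _ "\<lambda>x. x - 1" Suc]) auto

lemma entry_row_matrix_mult:
  assumes "A \<in> carrier_mat n n" "x \<in> {1..n}" "y \<in> {1..n}"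
  shows "entry (row_matrix n T * A) x y = (\<Sum>z\<in>{1..n}. T x z * entry A z y)"
proof -
  have "entry (row_matrix n T * A) x y = (\<Sum>i\<in>{0..<n}. T x (Suc i) * A $$ (i, y - 1))"
    using assms by (auto simp: entry_def row_matrix_def scalar_prod_def intro!: sum.cong)
  also have "\<dots> = (\<Sum>i\<in>{0..<n}. T x (Suc i) * entry A (Suc i) y)" by (simp add: entry_def)
  also have "\<dots> = (\<Sum>z\<in>{1..n}. T x z * entry A z y)" by (rule sum_shift_index)
  finally show ?thesis .
qed

lemma row_matrix_unitary:
  assumes "\<And>x x'. x \<in> {1..n} \<Longrightarrow> x' \<in> {1..n} \<Longrightarrow>
      (\<Sum>z\<in>{1..n}. T x z * cnj (T x' z)) = of_bool (x = x')"
  shows "row_matrix n T \<in> unitary_group n"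
proof -
  have "row_matrix n T * mat_adjoint (row_matrix n T) = 1\<^sub>m n"
  proof (rule eq_matI)
    fix i j assume ij: "i < dim_row (1\<^sub>m n)" "j < dim_col (1\<^sub>m n :: complex mat)"
    have "(row_matrix n T * mat_adjoint (row_matrix n T)) $$ (i, j)
        = (\<Sum>z\<in>{0..<n}. T (Suc i) (Suc z) * cnj (T (Suc j) (Suc z)))"
      using ij by (auto simp: row_matrix_def scalar_prod_def mat_adjoint_def mat_of_rows_def intro!: sum.cong)
    also have "\<dots> = (\<Sum>z\<in>{1..n}. T (Suc i) z * cnj (T (Suc j) z))"
      by (rule sum_shift_index[of "\<lambda>z. T (Suc i) z * cnj (T (Suc j) z)"])
    also have "\<dots> = of_bool (i = j)" using assms[of "Suc i" "Suc j"] ij by simp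
    finally show "(row_matrix n T * mat_adjoint (row_matrix n T)) $$ (i, j) = 1\<^sub>m n $$ (i, j)"
      using ij by simp
  qed (auto simp: row_matrix_def mat_adjoint_def)
  then show ?thesis by (simp add: unitary_group_def row_matrix_def)
qed

lemma mat_adjoint_carrier: "A \<in> carrier_mat n n \<Longrightarrow> mat_adjoint A \<in> carrier_mat n n"
  by (auto simp: mat_adjoint_def)

lemma mat_adjoint_index:
  assumes "A \<in> carrier_mat n n" "i < n" "j < n"
  shows "mat_adjoint A $$ (i, j) = cnj (A $$ (j, i))"
  using assms by (simp add: mat_adjoint_def mat_of_rows_def)

lemma unitary_rows:
  assumes "U \<in> unitary_group n" "x \<in> {1..n}" "y \<in> {1..n}"
  shows "(\<Sum>z\<in>{1..n}. entry U x z * cnj (entry U y z)) = of_bool (x = y)"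
proof -
  have U: "U \<in> carrier_mat n n" "U * mat_adjoint U = 1\<^sub>m n" using assms by (auto simp: unitary_group_def)
  have "(\<Sum>z\<in>{1..n}. entry U x z * cnj (entry U y z))
      = (\<Sum>z\<in>{0..<n}. entry U x (Suc z) * cnj (entry U y (Suc z)))"
    by (rule sum_shift_index[symmetric])
  also have "\<dots> = (U * mat_adjoint U) $$ (x - 1, y - 1)"
    using assms U(1) mat_adjoint_carrier[OF U(1)]
    by (auto simp: scalar_prod_def entry_def mat_adjoint_index[OF U(1)] intro!: sum.cong)
  also have "\<dots> = of_bool (x = y)" unfolding U(2) using assms by auto
  finally show ?thesis .
qed

lemma unitary_columns:
  assumes "U \<in> unitary_group n" "x \<in> {1..n}" "y \<in> {1..n}"
  shows "(\<Sum>z\<in>{1..n}. entry U z x * cnj (entry U z y)) = of_bool (x = y)"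
proof -
  have U: "U \<in> carrier_mat n n" "U * mat_adjoint U = 1\<^sub>m n" using assms by (auto simp: unitary_group_def)
  have U2: "mat_adjoint U * U = 1\<^sub>m n"
    using mat_mult_left_right_inverse[OF U(1) mat_adjoint_carrier[OF U(1)] U(2)] .
  have "(\<Sum>z\<in>{1..n}. entry U z x * cnj (entry U z y))
      = (\<Sum>z\<in>{0..<n}. entry U (Suc z) x * cnj (entry U (Suc z) y))"
    by (rule sum_shift_index[symmetric])
  also have "\<dots> = (mat_adjoint U * U) $$ (y - 1, x - 1)"
    using assms U(1) mat_adjoint_carrier[OF U(1)]
    by (auto simp: scalar_prod_def entry_def mat_adjoint_index[OF U(1)] mult.commute intro!: sum.cong)
  also have "\<dots> = of_bool (x = y)" unfolding U2 using assms by auto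
  finally show ?thesis .
qed

lemma unitary_entry_bound:
  assumes "U \<in> unitary_group n" "x \<in> {1..n}" "y \<in> {1..n}"
  shows "norm (entry U x y) \<le> 1"
proof -
  have "of_real (\<Sum>z\<in>{1..n}. (norm (entry U x z))\<^sup>2) = (1 :: complex)"
    unfolding of_real_sum complex_norm_square using unitary_rows[OF assms(1,2,2)] by simp
  then have "(\<Sum>z\<in>{1..n}. (norm (entry U x z))\<^sup>2) = 1" using of_real_eq_1_iff by blast
  moreover have "(norm (entry U x y))\<^sup>2 \<le> (\<Sum>z\<in>{1..n}. (norm (entry U x z))\<^sup>2)"
    using assms by (intro member_le_sum) auto
  ultimately show ?thesis by (simp add: abs_square_le_1)
qed

lemma unitary_mult:
  assumes "V \<in> unitary_group n" "U \<in> unitary_group n"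
  shows "V * U \<in> unitary_group n"
proof -
  have c: "V \<in> carrier_mat n n" "U \<in> carrier_mat n n"
    and u: "V * mat_adjoint V = 1\<^sub>m n" "U * mat_adjoint U = 1\<^sub>m n"
    using assms by (auto simp: unitary_group_def)
  note a = mat_adjoint_carrier[OF c(1)] mat_adjoint_carrier[OF c(2)]
  have adj: "mat_adjoint (V * U) = mat_adjoint U * mat_adjoint V"
  proof (rule eq_matI)
    fix i j assume "i < dim_row (mat_adjoint U * mat_adjoint V)" "j < dim_col (mat_adjoint U * mat_adjoint V)"
    then have ij: "i < n" "j < n" using a by auto
    show "mat_adjoint (V * U) $$ (i, j) = (mat_adjoint U * mat_adjoint V) $$ (i, j)"
      using ij a c by (auto simp: mat_adjoint_index[OF mult_carrier_mat[OF c]] scalar_prod_def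
          mat_adjoint_index[OF c(1)] mat_adjoint_index[OF c(2)] mult.commute intro!: sum.cong)
  qed (use a mat_adjoint_carrier[OF mult_carrier_mat[OF c]] in auto)
  have "V * U * (mat_adjoint U * mat_adjoint V) = V * (U * mat_adjoint U) * mat_adjoint V"
    using c a by (simp add: assoc_mult_mat[of _ n n _ n _ n] mult_carrier_mat[of _ n n])
  then show ?thesis using c a u by (simp add: unitary_group_def adj mult_carrier_mat[of _ n n])
qed

section \<open>Moments of the Haar measure\<close>

text \<open>
  Only rows are varied, column \<open>a\<close> belongs to the \<open>a\<close>-th factor. The Haar measure enters through
  left invariance, which acts on the rows.
\<close>

definition row_moment :: "complex mat measure \<Rightarrow> nat \<Rightarrow> (nat \<Rightarrow> nat) \<Rightarrow> (nat \<Rightarrow> nat) \<Rightarrow> complex" where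
  "row_moment \<mu> k r s =
     (\<integral>U. (\<Prod>a=1..k. entry U (r a) a) * cnj (\<Prod>a=1..k. entry U (s a) a) \<partial>\<mu>)"

lemma row_moment_cong:
  assumes "\<And>a. a \<in> {1..k} \<Longrightarrow> r a = r' a" "\<And>a. a \<in> {1..k} \<Longrightarrow> s a = s' a"
  shows "row_moment \<mu> k r s = row_moment \<mu> k r' s'"
  using assms unfolding row_moment_def by simp

context
  fixes n :: nat and \<mu> :: "complex mat measure"
  assumes haar: "haar_unitary n \<mu>"
begin

lemma haar_prob: "prob_space \<mu>" and haar_sets: "sets \<mu> = sets (unitary_borel n)"
  and haar_invariant: "V \<in> unitary_group n \<Longrightarrow> distr \<mu> \<mu> (\<lambda>A. V * A) = \<mu>"
  using haar by (auto simp: haar_unitary_def)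

lemma haar_space: "space \<mu> = unitary_group n"
  using sets_eq_imp_space_eq[OF haar_sets] by (simp add: unitary_borel_def)

lemma measurable_entries:
  "(\<lambda>A. \<lambda>ij\<in>{..<n} \<times> {..<n}. A $$ ij) \<in> \<mu> \<rightarrow>\<^sub>M PiM ({..<n} \<times> {..<n}) (\<lambda>_. borel)"
proof -
  have "(\<lambda>A. \<lambda>ij\<in>{..<n} \<times> {..<n}. A $$ ij) \<in> unitary_borel n \<rightarrow>\<^sub>M PiM ({..<n} \<times> {..<n}) (\<lambda>_. borel)"
    unfolding unitary_borel_def by (rule measurable_vimage_algebra1) (auto simp: space_PiM)
  then show ?thesis by (simp add: measurable_cong_sets[OF haar_sets refl])
qed

lemma measurable_entry_index:
  assumes "i < n" "j < n"
  shows "(\<lambda>A. A $$ (i, j)) \<in> borel_measurable \<mu>"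
proof -
  have "(\<lambda>A. (\<lambda>ij\<in>{..<n} \<times> {..<n}. A $$ ij) (i, j)) \<in> borel_measurable \<mu>"
    using assms by (intro measurable_compose[OF measurable_entries measurable_component_singleton]) auto
  then show ?thesis using assms by simp
qed

lemma measurable_entry:
  assumes "x \<in> {1..n}" "y \<in> {1..n}"
  shows "(\<lambda>A. entry A x y) \<in> borel_measurable \<mu>"
  unfolding entry_def using assms by (intro measurable_entry_index) auto

lemma measurable_left_mult:
  assumes V: "V \<in> unitary_group n"
  shows "(\<lambda>A. V * A) \<in> \<mu> \<rightarrow>\<^sub>M \<mu>"
proof -
  have c: "V \<in> carrier_mat n n" using V by (simp add: unitary_group_def)
  have "(\<lambda>A. V * A) \<in> \<mu> \<rightarrow>\<^sub>M unitary_borel n"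
    unfolding unitary_borel_def
  proof (rule measurable_vimage_algebra2)
    show "(\<lambda>A. V * A) \<in> space \<mu> \<rightarrow> unitary_group n"
      using unitary_mult[OF V] by (auto simp: haar_space)
    show "(\<lambda>A. \<lambda>ij\<in>{..<n} \<times> {..<n}. (V * A) $$ ij) \<in> \<mu> \<rightarrow>\<^sub>M PiM ({..<n} \<times> {..<n}) (\<lambda>_. borel)"
    proof (rule measurable_restrict)
      fix ij :: "nat \<times> nat" assume "ij \<in> {..<n} \<times> {..<n}"
      then obtain i j where ij: "ij = (i, j)" "i < n" "j < n" by auto
      have "(\<lambda>A. \<Sum>l\<in>{0..<n}. V $$ (i, l) * A $$ (l, j)) \<in> borel_measurable \<mu>"
        using ij by (intro borel_measurable_sum borel_measurable_times measurable_entry_index) auto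
      also have "?this \<longleftrightarrow> (\<lambda>A. (V * A) $$ ij) \<in> borel_measurable \<mu>"
        using ij c by (intro measurable_cong)
          (auto simp: haar_space unitary_group_def scalar_prod_def intro!: sum.cong)
      finally show "(\<lambda>A. (V * A) $$ ij) \<in> borel_measurable \<mu>" .
    qed
  qed
  then show ?thesis by (simp add: measurable_cong_sets[OF refl haar_sets])
qed

lemma integral_left_mult:
  fixes f :: "complex mat \<Rightarrow> complex"
  assumes "V \<in> unitary_group n" "f \<in> borel_measurable \<mu>"
  shows "(\<integral>A. f (V * A) \<partial>\<mu>) = (\<integral>A. f A \<partial>\<mu>)"
proof -
  have "(\<integral>A. f A \<partial>distr \<mu> \<mu> (\<lambda>A. V * A)) = (\<integral>A. f (V * A) \<partial>\<mu>)"
    by (rule integral_distr[OF measurable_left_mult[OF assms(1)] assms(2)])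
  then show ?thesis by (simp add: haar_invariant[OF assms(1)])
qed

lemma measurable_monomial:
  assumes "k \<le> n" "S \<subseteq> {1..k}" "T \<subseteq> {1..k}" "r \<in> S \<rightarrow> {1..n}" "s \<in> T \<rightarrow> {1..n}"
  shows "(\<lambda>U. (\<Prod>a\<in>S. entry U (r a) a) * cnj (\<Prod>a\<in>T. entry U (s a) a)) \<in> borel_measurable \<mu>"
proof -
  have "(\<lambda>U. (\<Prod>a\<in>S. entry U (r a) a)) \<in> borel_measurable \<mu>"
    using assms by (intro borel_measurable_prod measurable_entry) force+
  moreover have "(\<lambda>U. (\<Prod>a\<in>T. entry U (s a) a)) \<in> borel_measurable \<mu>"
    using assms by (intro borel_measurable_prod measurable_entry) force+
  ultimately show ?thesis
    by (intro borel_measurable_times measurable_compose[OF _ borel_measurable_continuous_onI[of cnj]]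
        continuous_on_cnj continuous_on_id)
qed

lemma integrable_monomial:
  assumes "k \<le> n" "S \<subseteq> {1..k}" "T \<subseteq> {1..k}" "r \<in> S \<rightarrow> {1..n}" "s \<in> T \<rightarrow> {1..n}"
  shows "integrable \<mu> (\<lambda>U. (\<Prod>a\<in>S. entry U (r a) a) * cnj (\<Prod>a\<in>T. entry U (s a) a))"
proof -
  interpret prob_space \<mu> by (rule haar_prob)
  have "norm ((\<Prod>a\<in>S. entry U (r a) a) * cnj (\<Prod>a\<in>T. entry U (s a) a)) \<le> 1"
    if U: "U \<in> unitary_group n" for U
  proof -
    have "(\<Prod>a\<in>S. norm (entry U (r a) a)) \<le> 1"
      using assms U by (intro prod_le_1 conjI norm_ge_zero unitary_entry_bound) force+
    moreover have "(\<Prod>a\<in>T. norm (entry U (s a) a)) \<le> 1"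
      using assms U by (intro prod_le_1 conjI norm_ge_zero unitary_entry_bound) force+
    ultimately show ?thesis
      by (simp add: norm_mult prod_norm[symmetric] mult_le_one prod_nonneg)
  qed
  then show ?thesis
    using measurable_monomial[OF assms]
    by (intro integrable_const_bound[where B = 1]) (auto simp: haar_space)
qed

text \<open>
  Left multiplication with a permutation matrix.
\<close>

lemma row_moment_permute:
  assumes "k \<le> n" and p: "p permutes {1..n}" and r: "r \<in> {1..k} \<rightarrow> {1..n}" and s: "s \<in> {1..k} \<rightarrow> {1..n}"
  shows "row_moment \<mu> k (p \<circ> r) (p \<circ> s) = row_moment \<mu> k r s"
proof -
  define T where "T x z = (of_bool (z = p x) :: complex)" for x z
  have pin: "p x \<in> {1..n}" if "x \<in> {1..n}" for x using p that permutes_in_image by metis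
  have V: "row_matrix n T \<in> unitary_group n"
  proof (rule row_matrix_unitary)
    fix x x' assume x: "x \<in> {1..n}" "x' \<in> {1..n}"
    have "T x z * cnj (T x' z) = (if z = p x then of_bool (x = x') else 0)" for z
      using injD[OF permutes_inj[OF p], of x x'] by (auto simp: T_def)
    then show "(\<Sum>z\<in>{1..n}. T x z * cnj (T x' z)) = of_bool (x = x')"
      using pin[OF x(1)] by simp
  qed
  have act: "entry (row_matrix n T * U) x a = entry U (p x) a"
    if "U \<in> unitary_group n" "x \<in> {1..n}" "a \<in> {1..k}" for U x a
  proof -
    have "entry (row_matrix n T * U) x a = (\<Sum>z\<in>{1..n}. T x z * entry U z a)"
      using that assms(1) by (intro entry_row_matrix_mult) (auto simp: unitary_group_def)
    also have "\<dots> = (\<Sum>z\<in>{1..n}. if z = p x then entry U z a else 0)"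
      by (intro sum.cong) (auto simp: T_def)
    finally show ?thesis using pin[OF that(2)] by simp
  qed
  let ?f = "\<lambda>U. (\<Prod>a=1..k. entry U (r a) a) * cnj (\<Prod>a=1..k. entry U (s a) a)"
  have "row_moment \<mu> k r s = (\<integral>U. ?f (row_matrix n T * U) \<partial>\<mu>)"
    unfolding row_moment_def using assms
    by (intro integral_left_mult[OF V, symmetric] measurable_monomial) auto
  also have "\<dots> = row_moment \<mu> k (p \<circ> r) (p \<circ> s)"
    unfolding row_moment_def using r s
    by (intro Bochner_Integration.integral_cong refl) (auto simp: haar_space act Pi_iff intro!: prod.cong arg_cong2[where f = times])
  finally show ?thesis by simp
qed

text \<open>
  The permutation of columns in the definition is a permutation of rows by \<open>\<pi>\<^sup>-\<^sup>1\<close>, after reordering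
  the product; then all rows are permuted by \<open>\<pi>\<close>.
\<close>

lemma weingarten_eq_row_moment:
  assumes "k \<le> n" "\<pi> \<in> perms k"
  shows "weingarten \<mu> k \<pi> = row_moment \<mu> k \<pi> id"
proof -
  have p: "\<pi> permutes {1..k}" using assms by (simp add: perms_def)
  let ?q = "inv_into UNIV \<pi>"
  have "(\<Prod>i=1..k. U $$ (i - 1, \<pi> i - 1)) = (\<Prod>a=1..k. entry U (?q a) a)" for U :: "complex mat"
    using prod.permute[OF p, of "\<lambda>a. entry U (?q a) a"] permutes_inverses(2)[OF p]
    by (simp add: entry_def comp_def)
  then have "weingarten \<mu> k \<pi> = row_moment \<mu> k id ?q"
    by (simp add: weingarten_def row_moment_def entry_def)
  also have "\<dots> = row_moment \<mu> k (\<pi> \<circ> id) (\<pi> \<circ> ?q)"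
  proof (rule row_moment_permute[symmetric])
    show "?q \<in> {1..k} \<rightarrow> {1..n}"
    proof
      fix a assume "a \<in> {1..k}"
      then have "?q a \<in> {1..k}" using permutes_in_image[OF permutes_inv[OF p]] by simp
      then show "?q a \<in> {1..n}" using assms(1) by simp
    qed
  qed (use assms(1) permutes_subset[OF p, of "{1..n}"] in auto)
  finally show ?thesis using perms_inverse[OF assms(2)] by simp
qed

text \<open>
  Multiply with the unitary
  matrices that send row \<open>p\<close> to \<open>(p + \<epsilon> q) / \<surd>2\<close> and row \<open>q\<close> to \<open>(p - \<epsilon> q) / \<surd>2\<close>, expand, and
  average over the fourth roots of unity \<open>\<epsilon>\<close>. This kills the terms in which the two sides
  contain \<open>q\<close> a different number of times. Writing \<open>A\<close> for the moment with \<open>p\<close> everywhere, and \<open>B\<close>, \<open>C\<close> for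
  the two moments on the right, the symmetry between \<open>p\<close> and \<open>q\<close> leaves \<open>4 A = 2 A + 2 B + 2 C\<close>.
\<close>

lemma row_moment_repeated_row:
  assumes k: "k \<le> n" and pq: "p \<in> {1..n}" "q \<in> {1..n}" "p \<noteq> q"
    and r: "r \<in> {1..k} \<rightarrow> {1..n}" and s: "s \<in> {1..k} \<rightarrow> {1..n}"
    and \<alpha>\<beta>: "\<alpha> \<in> {1..k}" "\<beta> \<in> {1..k}" "\<alpha> \<noteq> \<beta>" and \<gamma>\<delta>: "\<gamma> \<in> {1..k}" "\<delta> \<in> {1..k}" "\<gamma> \<noteq> \<delta>"
    and rp: "r \<alpha> = p" "r \<beta> = p" "\<And>a. a \<in> {1..k} - {\<alpha>, \<beta>} \<Longrightarrow> r a \<notin> {p, q}"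
    and sp: "s \<gamma> = p" "s \<delta> = p" "\<And>a. a \<in> {1..k} - {\<gamma>, \<delta>} \<Longrightarrow> s a \<notin> {p, q}"
  shows "row_moment \<mu> k r s
       = row_moment \<mu> k (r(\<beta> := q)) (s(\<delta> := q)) + row_moment \<mu> k (r(\<beta> := q)) (s(\<gamma> := q))"
proof -
  define P where "P U = (\<Prod>a\<in>{1..k} - {\<alpha>, \<beta>}. entry U (r a) a)" for U
  define Q where "Q U = (\<Prod>a\<in>{1..k} - {\<gamma>, \<delta>}. entry U (s a) a)" for U
  define m where "m c1 c2 d1 d2 U = entry U c1 \<alpha> * entry U c2 \<beta> * P U
      * cnj (entry U d1 \<gamma> * entry U d2 \<delta> * Q U)" for c1 c2 d1 d2 U
  define M where "M c1 c2 d1 d2 = row_moment \<mu> k (r(\<alpha> := c1, \<beta> := c2)) (s(\<gamma> := d1, \<delta> := d2))"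
    for c1 c2 d1 d2
  have split: "(\<Prod>a=1..k. entry U ((r(\<alpha> := c1, \<beta> := c2)) a) a) = entry U c1 \<alpha> * entry U c2 \<beta> * P U"
    "(\<Prod>a=1..k. entry U ((s(\<gamma> := c1, \<delta> := c2)) a) a) = entry U c1 \<gamma> * entry U c2 \<delta> * Q U"
    for U c1 c2
  proof -
    have "{1..k} = insert \<alpha> (insert \<beta> ({1..k} - {\<alpha>, \<beta>}))" using \<alpha>\<beta> by auto
    then have "(\<Prod>a=1..k. entry U ((r(\<alpha> := c1, \<beta> := c2)) a) a)
        = (\<Prod>a\<in>insert \<alpha> (insert \<beta> ({1..k} - {\<alpha>, \<beta>})). entry U ((r(\<alpha> := c1, \<beta> := c2)) a) a)"
      by (rule prod.cong) simp
    then show "(\<Prod>a=1..k. entry U ((r(\<alpha> := c1, \<beta> := c2)) a) a) = entry U c1 \<alpha> * entry U c2 \<beta> * P U"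
      using \<alpha>\<beta>(3) by (simp add: P_def mult.assoc)
    have "{1..k} = insert \<gamma> (insert \<delta> ({1..k} - {\<gamma>, \<delta>}))" using \<gamma>\<delta> by auto
    then have "(\<Prod>a=1..k. entry U ((s(\<gamma> := c1, \<delta> := c2)) a) a)
        = (\<Prod>a\<in>insert \<gamma> (insert \<delta> ({1..k} - {\<gamma>, \<delta>})). entry U ((s(\<gamma> := c1, \<delta> := c2)) a) a)"
      by (rule prod.cong) simp
    then show "(\<Prod>a=1..k. entry U ((s(\<gamma> := c1, \<delta> := c2)) a) a) = entry U c1 \<gamma> * entry U c2 \<delta> * Q U"
      using \<gamma>\<delta>(3) by (simp add: Q_def mult.assoc)
  qed
  have M_integral: "M c1 c2 d1 d2 = (\<integral>U. m c1 c2 d1 d2 U \<partial>\<mu>)" for c1 c2 d1 d2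
    unfolding M_def row_moment_def m_def split ..
  have range: "r(\<alpha> := c1, \<beta> := c2) \<in> {1..k} \<rightarrow> {1..n}" "s(\<gamma> := c1, \<delta> := c2) \<in> {1..k} \<rightarrow> {1..n}"
    if "c1 \<in> {1..n}" "c2 \<in> {1..n}" for c1 c2
    using r s that by auto
  have int: "integrable \<mu> (m c1 c2 d1 d2)"
    if "c1 \<in> {1..n}" "c2 \<in> {1..n}" "d1 \<in> {1..n}" "d2 \<in> {1..n}" for c1 c2 d1 d2
    using integrable_monomial[OF k subset_refl subset_refl range(1)[OF that(1,2)] range(2)[OF that(3,4)]]
    unfolding split m_def .

  define c where "c = (of_real (1 / sqrt 2) :: complex)"
  have c: "c * c = 1 / 2" "cnj c = c"
    unfolding c_def of_real_mult[symmetric] by simp_all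
  define R where "R \<epsilon> U = (1/4) *
      ((entry U p \<alpha> + \<epsilon> * entry U q \<alpha>) * (entry U p \<beta> + \<epsilon> * entry U q \<beta>) * P U *
       cnj ((entry U p \<gamma> + \<epsilon> * entry U q \<gamma>) * (entry U p \<delta> + \<epsilon> * entry U q \<delta>) * Q U))"
    for \<epsilon> U
  have rotate: "M p p p p = integral\<^sup>L \<mu> (R \<epsilon>)"
    if \<epsilon>: "\<epsilon> * cnj \<epsilon> = 1" for \<epsilon>
  proof -
    \<comment> \<open>Row \<open>x\<close> becomes \<open>u x\<close> times row \<open>p\<close> plus \<open>v x\<close> times row \<open>q\<close> plus \<open>w x\<close> times row \<open>x\<close>; this form
    makes sums over \<open>{1..n}\<close> collapse.\<close>
    define u v w where "u x = (if x = p \<or> x = q then c else 0)"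
      and "v x = (if x = p then c * \<epsilon> else if x = q then - c * \<epsilon> else 0)"
      and "w x = (if x = p \<or> x = q then 0 else 1 :: complex)" for x
    define T where "T x z = of_bool (z = p) * u x + of_bool (z = q) * v x + of_bool (z = x) * w x" for x z
    have Tsum: "(\<Sum>z\<in>{1..n}. T x z * f z) = u x * f p + v x * f q + w x * f x" if "x \<in> {1..n}" for x f
    proof -
      have "(\<Sum>z\<in>{1..n}. T x z * f z) = (\<Sum>z\<in>{1..n}. if z = p then u x * f z else 0)
          + (\<Sum>z\<in>{1..n}. if z = q then v x * f z else 0) + (\<Sum>z\<in>{1..n}. if z = x then w x * f z else 0)"
        unfolding T_def sum.distrib[symmetric] by (intro sum.cong) (auto simp: algebra_simps)
      then show ?thesis using pq that by simp
    qed
    have cc: "c * (\<epsilon> * (c * cnj \<epsilon>)) = 1 / 2"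
      using c(1) \<epsilon> by (metis mult.assoc mult.commute mult.right_neutral)
    have V: "row_matrix n T \<in> unitary_group n"
    proof (rule row_matrix_unitary)
      fix x x' assume x: "x \<in> {1..n}" "x' \<in> {1..n}"
      have "T x' p = u x'" "T x' q = v x'" "w x * cnj (T x' x) = of_bool (x = x') * w x"
        using pq(3) by (auto simp: T_def u_def v_def w_def)
      then have "(\<Sum>z\<in>{1..n}. T x z * cnj (T x' z))
          = u x * cnj (u x') + v x * cnj (v x') + of_bool (x = x') * w x"
        using Tsum[OF x(1), of "\<lambda>z. cnj (T x' z)"] by simp
      also have "\<dots> = of_bool (x = x')"
      proof -
        have uv: "u p = c" "u q = c" "v p = c * \<epsilon>" "v q = - (c * \<epsilon>)" "w p = 0" "w q = 0"
          using pq(3) by (simp_all add: u_def v_def w_def)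
        have other: "u y = 0" "v y = 0" "w y = 1" if "y \<noteq> p" "y \<noteq> q" for y
          using that by (simp_all add: u_def v_def w_def)
        have cc': "c * \<epsilon> * (c * cnj \<epsilon>) = 1 / 2" using cc by (simp only: mult.assoc)
        consider "x = p" | "x = q" | "x \<noteq> p" "x \<noteq> q" by blast
        then show ?thesis
          by cases (cases "x' = p"; cases "x' = q"; use pq(3) in \<open>simp add: uv other c cc'\<close>)+
      qed
      finally show "(\<Sum>z\<in>{1..n}. T x z * cnj (T x' z)) = of_bool (x = x')" .
    qed
    have act: "entry (row_matrix n T * U) x a = u x * entry U p a + v x * entry U q a + w x * entry U x a"
      if "U \<in> unitary_group n" "x \<in> {1..n}" "a \<in> {1..k}" for U x a
    proof -
      have "entry (row_matrix n T * U) x a = (\<Sum>z\<in>{1..n}. T x z * entry U z a)"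
        using that k by (intro entry_row_matrix_mult) (auto simp: unitary_group_def)
      then show ?thesis using Tsum[OF that(2)] by simp
    qed
    have "M p p p p = (\<integral>U. m p p p p (row_matrix n T * U) \<partial>\<mu>)"
      unfolding M_integral
      by (intro integral_left_mult[OF V, symmetric] borel_measurable_integrable int pq)
    also have "\<dots> = integral\<^sup>L \<mu> (R \<epsilon>)"
    proof (intro Bochner_Integration.integral_cong refl)
      fix U assume "U \<in> space \<mu>"
      then have U: "U \<in> unitary_group n" by (simp add: haar_space)
      have ep: "entry (row_matrix n T * U) p a = c * (entry U p a + \<epsilon> * entry U q a)"
        if "a \<in> {1..k}" for a
        using act[OF U pq(1) that] by (simp add: u_def v_def w_def algebra_simps)
      have eo: "entry (row_matrix n T * U) x a = entry U x a"
        if "a \<in> {1..k}" "x \<in> {1..n}" "x \<notin> {p, q}" for x a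
        using act[OF U that(2,1)] that(3) by (simp add: u_def v_def w_def)
      have PQ: "P (row_matrix n T * U) = P U" "Q (row_matrix n T * U) = Q U"
      proof -
        have "entry (row_matrix n T * U) (r a) a = entry U (r a) a" if "a \<in> {1..k} - {\<alpha>, \<beta>}" for a
          using that r rp(3)[OF that] by (intro eo) (simp_all add: Pi_iff)
        then show "P (row_matrix n T * U) = P U" unfolding P_def by (rule prod.cong[OF refl])
        have "entry (row_matrix n T * U) (s a) a = entry U (s a) a" if "a \<in> {1..k} - {\<gamma>, \<delta>}" for a
          using that s sp(3)[OF that] by (intro eo) (simp_all add: Pi_iff)
        then show "Q (row_matrix n T * U) = Q U" unfolding Q_def by (rule prod.cong[OF refl])
      qed
      have "m p p p p (row_matrix n T * U) = ((c * c) * (c * c)) *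
      ((entry U p \<alpha> + \<epsilon> * entry U q \<alpha>) * (entry U p \<beta> + \<epsilon> * entry U q \<beta>) * P U *
       cnj ((entry U p \<gamma> + \<epsilon> * entry U q \<gamma>) * (entry U p \<delta> + \<epsilon> * entry U q \<delta>) * Q U))"
        unfolding m_def PQ ep[OF \<alpha>\<beta>(1)] ep[OF \<alpha>\<beta>(2)] ep[OF \<gamma>\<delta>(1)] ep[OF \<gamma>\<delta>(2)]
        by (simp only: complex_cnj_mult c(2) mult_ac)
      then show "m p p p p (row_matrix n T * U) = R \<epsilon> U" by (simp add: c(1) R_def)
    qed
    finally show ?thesis .
  qed
  \<comment> \<open>Sorted by the powers of \<open>\<epsilon>\<close> and \<open>cnj \<epsilon>\<close>: only the monomials with equal powers survive the
  average.\<close>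
  have R_expand: "R \<epsilon> U = (1/4) * (m p p p p U + m q q q q U * (\<epsilon> * \<epsilon> * cnj \<epsilon> * cnj \<epsilon>)
      + (m p q p q U + m p q q p U + m q p p q U + m q p q p U) * (\<epsilon> * cnj \<epsilon>)
      + (m p q p p U + m q p p p U) * \<epsilon> + (m p p p q U + m p p q p U) * cnj \<epsilon>
      + m q q p p U * (\<epsilon> * \<epsilon>) + m p p q q U * (cnj \<epsilon> * cnj \<epsilon>)
      + (m q q p q U + m q q q p U) * (\<epsilon> * \<epsilon> * cnj \<epsilon>)
      + (m p q q q U + m q p q q U) * (\<epsilon> * cnj \<epsilon> * cnj \<epsilon>))" for \<epsilon> U
    unfolding R_def m_def complex_cnj_mult complex_cnj_add by (simp add: algebra_simps)
  have average: "R 1 U + R (-1) U + R \<i> U + R (-\<i>) U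
      = m p p p p U + m q q q q U + m p q p q U + m p q q p U + m q p p q U + m q p q p U" for U
    unfolding R_expand by (simp add: algebra_simps)
  have R_int: "integrable \<mu> (R \<epsilon>)" for \<epsilon>
    unfolding R_expand
    by (intro Bochner_Integration.integrable_add integrable_mult_right integrable_mult_left int pq)
  have "4 * M p p p p = M p p p p + M p p p p + M p p p p + M p p p p" by simp
  also have "\<dots> = integral\<^sup>L \<mu> (R 1) + integral\<^sup>L \<mu> (R (-1)) + integral\<^sup>L \<mu> (R \<i>) + integral\<^sup>L \<mu> (R (-\<i>))"
    by (intro arg_cong2[where f = plus] rotate) simp_all
  also have "\<dots> = (\<integral>U. R 1 U + R (-1) U + R \<i> U + R (-\<i>) U \<partial>\<mu>)"
    by (simp only: Bochner_Integration.integral_add Bochner_Integration.integrable_add R_int)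
  also have "\<dots> = M p p p p + M q q q q + M p q p q + M p q q p + M q p p q + M q p q p"
    unfolding average M_integral
    by (simp only: Bochner_Integration.integral_add Bochner_Integration.integrable_add int pq)
  finally have eq: "4 * M p p p p = M p p p p + M q q q q + M p q p q + M p q q p + M q p p q + M q p q p" .

  let ?t = "transposition p q"
  have t: "?t permutes {1..n}" using pq by (intro permutes_swap_id) auto
  have swap: "M (?t c1) (?t c2) (?t d1) (?t d2) = M c1 c2 d1 d2"
    if cd: "c1 \<in> {p, q}" "c2 \<in> {p, q}" "d1 \<in> {p, q}" "d2 \<in> {p, q}" for c1 c2 d1 d2
  proof -
    have cd': "c1 \<in> {1..n}" "c2 \<in> {1..n}" "d1 \<in> {1..n}" "d2 \<in> {1..n}" using cd pq by auto
    have "M (?t c1) (?t c2) (?t d1) (?t d2)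
        = row_moment \<mu> k (?t \<circ> r(\<alpha> := c1, \<beta> := c2)) (?t \<circ> s(\<gamma> := d1, \<delta> := d2))"
      unfolding M_def
    proof (rule row_moment_cong)
      fix a assume a: "a \<in> {1..k}"
      show "(r(\<alpha> := ?t c1, \<beta> := ?t c2)) a = (?t \<circ> r(\<alpha> := c1, \<beta> := c2)) a"
        using rp(3)[of a] a by (auto simp: Transposition.transpose_def)
      show "(s(\<gamma> := ?t d1, \<delta> := ?t d2)) a = (?t \<circ> s(\<gamma> := d1, \<delta> := d2)) a"
        using sp(3)[of a] a by (auto simp: Transposition.transpose_def)
    qed
    then show ?thesis unfolding M_def
      using row_moment_permute[OF k t range(1)[OF cd'(1,2)] range(2)[OF cd'(3,4)]] by simp
  qed
  have "M q q q q = M p p p p" "M q p q p = M p q p q" "M q p p q = M p q q p"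
    using swap[of p p p p] swap[of p q p q] swap[of p q q p] by simp_all
  then have "2 * M p p p p = 2 * (M p q p q + M p q q p)" using eq by (simp add: distrib_left)
  then have "M p p p p = M p q p q + M p q q p" by (metis mult_cancel_left zero_neq_numeral)
  moreover have "M p p p p = row_moment \<mu> k r s" "M p q p q = row_moment \<mu> k (r(\<beta> := q)) (s(\<delta> := q))"
    "M p q q p = row_moment \<mu> k (r(\<beta> := q)) (s(\<gamma> := q))"
    unfolding M_def using rp sp \<alpha>\<beta> \<gamma>\<delta> by (auto intro!: row_moment_cong)
  ultimately show ?thesis by simp
qed

section \<open>The Weingarten function\<close>

text \<open>
  Replace \<open>k\<close> by a row \<open>x\<close> both in the values of \<open>\<pi>\<close> and in those of the identity, and sum the moments
  over \<open>x\<close>. Orthonormality of the columns evaluates the sum: it is zero unless \<open>\<pi>\<close> fixes \<open>k\<close>, and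
  then a moment of order \<open>k - 1\<close>. On the other hand, each \<open>x \<ge> k\<close> contributes the Weingarten function
  of \<open>\<pi>\<close> by permuting rows, while \<open>x = i < k\<close> is a row that occurs twice on both sides and contributes the
  Weingarten functions of \<open>\<pi>\<close> and of \<open>\<pi>\<close> multiplied by the transposition of \<open>i\<close> and \<open>k\<close>.
\<close>

lemma weingarten_haar_relation:
  assumes k: "0 < k" "k \<le> n"
  shows "weingarten_relation n k (weingarten \<mu> k) (weingarten \<mu> (k - 1))"
  unfolding weingarten_relation_def
proof
  fix \<pi> assume \<pi>: "\<pi> \<in> perms k"
  let ?\<tau> = "\<lambda>i. transposition i k"
  define W where "W \<rho> = row_moment \<mu> k \<rho> id" for \<rho>
  have p: "\<pi> permutes {1..k}" using \<pi> by (simp add: perms_def)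
  note inj = permutes_inj[OF p]
  have \<pi>_in: "\<pi> a \<in> {1..k}" if "a \<in> {1..k}" for a using that permutes_in_image[OF p] by simp
  have kin: "k \<in> {1..k}" using k by simp
  obtain j where j: "j \<in> {1..k}" "\<pi> j = k"
    using kin permutes_image[OF p] by (metis imageE)
  have \<pi>_j: "\<pi> a = k \<longleftrightarrow> a = j" for a using j injD[OF inj, of a j] by auto
  define r s where "r x = \<pi>(j := x)" and "s x = id(k := x)" for x :: nat
  have r: "r x \<in> {1..k} \<rightarrow> {1..n}" and s: "s x \<in> {1..k} \<rightarrow> {1..n}" if "x \<in> {1..n}" for x
    using that k \<pi>_in by (fastforce simp: r_def s_def)+

  have high: "row_moment \<mu> k (r x) (s x) = W \<pi>" if x: "x \<in> {k..n}" for x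
  proof -
    have "row_moment \<mu> k (r x) (s x) = row_moment \<mu> k (transposition x k \<circ> r x) (transposition x k \<circ> s x)"
      using x k r[of x] s[of x] by (intro row_moment_permute[symmetric] permutes_swap_id) auto
    also have "\<dots> = row_moment \<mu> k \<pi> id"
    proof (rule row_moment_cong)
      fix a assume a: "a \<in> {1..k}"
      show "(transposition x k \<circ> r x) a = \<pi> a"
        using \<pi>_j[of a] \<pi>_in[OF a] x by (auto simp: r_def Transposition.transpose_def)
      show "(transposition x k \<circ> s x) a = id a"
        using a x by (auto simp: s_def Transposition.transpose_def)
    qed
    finally show ?thesis by (simp add: W_def)
  qed
  have low: "row_moment \<mu> k (r i) (s i) = W \<pi> + W (?\<tau> i \<circ> \<pi>)" if i: "i \<in> {1..<k}" for i
  proof -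
    have iin: "i \<in> {1..k}" "i \<in> {1..n}" "k \<in> {1..n}" "i \<noteq> k" using i k by auto
    obtain l where l: "l \<in> {1..k}" "\<pi> l = i"
      using iin(1) permutes_image[OF p] by (metis imageE)
    have lj: "l \<noteq> j" using l j iin by auto
    have "row_moment \<mu> k (r i) (s i)
        = row_moment \<mu> k ((r i)(j := k)) ((s i)(k := k)) + row_moment \<mu> k ((r i)(j := k)) ((s i)(i := k))"
    proof (rule row_moment_repeated_row[OF k(2) iin(2,3,4) r[OF iin(2)] s[OF iin(2)]
          l(1) j(1) lj iin(1) kin iin(4)])
      show "r i a \<notin> {i, k}" if "a \<in> {1..k} - {l, j}" for a
        using that \<pi>_j[of a] l injD[OF inj, of a l] by (auto simp: r_def)
    qed (use l lj iin(4) in \<open>auto simp: r_def s_def\<close>)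
    also have "(r i)(j := k) = \<pi>" using j by (auto simp: r_def)
    also have "(s i)(k := k) = id" by (auto simp: s_def)
    also have "(s i)(i := k) = ?\<tau> i" by (auto simp: s_def Transposition.transpose_def)
    also have "row_moment \<mu> k \<pi> (?\<tau> i) = row_moment \<mu> k (?\<tau> i \<circ> \<pi>) (?\<tau> i \<circ> ?\<tau> i)"
    proof (rule row_moment_permute[symmetric, OF k(2)])
      show "?\<tau> i \<in> {1..k} \<rightarrow> {1..n}" using iin k by (auto simp: Transposition.transpose_def)
      show "\<pi> \<in> {1..k} \<rightarrow> {1..n}" using \<pi>_in k by fastforce
    qed (intro permutes_swap_id iin)
    finally show ?thesis by (simp add: W_def id_def)
  qed
  have "{1..n} = {1..<k} \<union> {k..n}" using k by auto
  then have "(\<Sum>x\<in>{1..n}. row_moment \<mu> k (r x) (s x))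
      = (\<Sum>x\<in>{1..<k}. row_moment \<mu> k (r x) (s x)) + (\<Sum>x\<in>{k..n}. row_moment \<mu> k (r x) (s x))"
    by (simp only:) (rule sum.union_disjoint, auto)
  also have "\<dots> = (\<Sum>i\<in>{1..<k}. W \<pi> + W (?\<tau> i \<circ> \<pi>)) + (\<Sum>x\<in>{k..n}. W \<pi>)"
    by (intro arg_cong2[where f = plus] sum.cong refl low high)
  also have "\<dots> = of_nat (k - 1 + (Suc n - k)) * W \<pi> + (\<Sum>i\<in>{1..<k}. W (?\<tau> i \<circ> \<pi>))"
    by (simp add: sum.distrib distrib_right)
  also have "k - 1 + (Suc n - k) = n" using k by simp
  finally have total: "(\<Sum>x\<in>{1..n}. row_moment \<mu> k (r x) (s x))
      = of_nat n * W \<pi> + (\<Sum>i\<in>{1..<k}. W (?\<tau> i \<circ> \<pi>))" .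

  let ?P = "\<lambda>U. \<Prod>a\<in>{1..k} - {j}. entry U (\<pi> a) a" and ?Q = "\<lambda>U. \<Prod>a\<in>{1..k} - {k}. entry U a a"
  have split: "(\<Prod>a=1..k. entry U (r x a) a) * cnj (\<Prod>a=1..k. entry U (s x a) a)
      = (entry U x j * cnj (entry U x k)) * (?P U * cnj (?Q U))" for U x
  proof -
    have "(\<Prod>a=1..k. entry U (r x a) a) = entry U x j * ?P U"
      by (subst prod.remove[OF _ j(1)]) (auto simp: r_def)
    moreover have "(\<Prod>a=1..k. entry U (s x a) a) = entry U x k * ?Q U"
      by (subst prod.remove[OF _ kin]) (auto simp: s_def)
    ultimately show ?thesis by simp
  qed
  have "(\<Sum>x\<in>{1..n}. row_moment \<mu> k (r x) (s x))
      = (\<integral>U. (\<Sum>x\<in>{1..n}. (\<Prod>a=1..k. entry U (r x a) a) * cnj (\<Prod>a=1..k. entry U (s x a) a)) \<partial>\<mu>)"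
    unfolding row_moment_def using k r s
    by (intro Bochner_Integration.integral_sum[symmetric] integrable_monomial) auto
  also have "\<dots> = (\<integral>U. of_bool (j = k) * (?P U * cnj (?Q U)) \<partial>\<mu>)"
  proof (intro Bochner_Integration.integral_cong refl)
    fix U assume "U \<in> space \<mu>"
    then have "U \<in> unitary_group n" by (simp add: haar_space)
    then show "(\<Sum>x\<in>{1..n}. (\<Prod>a=1..k. entry U (r x a) a) * cnj (\<Prod>a=1..k. entry U (s x a) a))
        = of_bool (j = k) * (?P U * cnj (?Q U))"
      unfolding split sum_distrib_right[symmetric] using unitary_columns[of U n j k] j k by simp
  qed
  also have "\<dots> = (if \<pi> k = k then row_moment \<mu> (k - 1) \<pi> id else 0)"
  proof (cases "j = k")
    case True
    have "\<pi> k = k" using j(2) unfolding True .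
    moreover have "{1..k} - {k} = {1..k - 1}" by auto
    ultimately show ?thesis unfolding True by (simp add: row_moment_def del: One_nat_def)
  next
    case False
    then have "\<pi> k \<noteq> k" using \<pi>_j by metis
    then show ?thesis using False by simp
  qed
  also have "\<dots> = (if \<pi> k = k then weingarten \<mu> (k - 1) \<pi> else 0)"
    using weingarten_eq_row_moment[of "k - 1" \<pi>] perms_fix_last[OF k(1) \<pi>] k by simp
  finally have "of_nat n * W \<pi> + (\<Sum>i\<in>{1..<k}. W (?\<tau> i \<circ> \<pi>))
      = (if \<pi> k = k then weingarten \<mu> (k - 1) \<pi> else 0)"
    using total by simp
  moreover have "W \<rho> = weingarten \<mu> k \<rho>" if "\<rho> \<in> perms k" for \<rho>
    using weingarten_eq_row_moment[OF k(2) that] by (simp add: W_def)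
  ultimately show "of_nat n * weingarten \<mu> k \<pi> + (\<Sum>i\<in>{1..<k}. weingarten \<mu> k (?\<tau> i \<circ> \<pi>))
      = (if \<pi> k = k then weingarten \<mu> (k - 1) \<pi> else 0)"
    using \<pi> perms_comp[OF transposition_perms \<pi>] by simp
qed

lemma weingarten_eq_ascension_chain:
  assumes "k \<le> n" "\<pi> \<in> perms k"
  shows "weingarten \<mu> k \<pi> = ascension_chain k (n - k) \<pi>"
  using assms
proof (induction k arbitrary: \<pi>)
  case 0
  interpret prob_space \<mu> by (rule haar_prob)
  show ?case by (simp add: weingarten_def ascension_chain_0 prob_space)
next
  case (Suc k)
  have below: "weingarten \<mu> (Suc k - 1) \<sigma> = ascension_chain (Suc k - 1) (n - (Suc k - 1)) \<sigma>"
    if "\<sigma> \<in> perms (Suc k - 1)" for \<sigma>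
    using Suc.IH[of \<sigma>] Suc.prems(1) that by simp
  show ?case
    by (rule weingarten_relation_unique[OF zero_less_Suc Suc.prems(1)
          weingarten_haar_relation[OF zero_less_Suc Suc.prems(1)]
          ascension_chain_relation[OF zero_less_Suc Suc.prems(1)] below Suc.prems(2)])
qed

end

theorem proposition3p11:
  fixes k n :: nat and \<pi> :: "nat \<Rightarrow> nat" and \<mu> :: "complex mat measure"
  assumes "0 < k" and "k \<le> n"
    and "haar_unitary n \<mu>"
    and "\<pi> permutes {1..k}"
  shows "weingarten \<mu> k \<pi> =
    (\<Sum>(\<sigma>, \<tau>) \<in> (\<Pi>\<^sub>E m\<in>{k..<n}. {p. p permutes {1..k}}) \<times> (\<Pi>\<^sub>E j\<in>{2..<k}. {p. p permutes {1..j}}).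
       let \<sigma>' = \<sigma>(n := \<pi>); \<tau>' = \<tau>(k := \<sigma>' k, 1 := id) in
         (\<Prod>m=k+1..n. ascension k m (\<sigma>' m \<circ> inv_into UNIV (\<sigma>' (m - 1)))) *
         (\<Prod>j=2..k. a_fun j (\<tau>' j) (\<tau>' (j - 1))))"
  using weingarten_eq_ascension_chain[OF assms(3,2)] ascension_chain_eq_sum[OF assms(1,2)] assms(4)
  by (simp only: perms_def mem_Collect_eq)

end
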